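(* Let $\beta>0$, $\gamma\ge0$, $\mu\ge0$, $\eta\in\mathbb{R}$, $N\in\mathbb{N}_0$ and $f\in(H^1(\Lambda))'$. Let $u$ be the (weak) solution of the Robin problem $$-u''(x)+\gamma u(x)=f(x),\ x\in\Lambda,\qquad -u'(0)+\mu u(0)=\eta,\qquad \lim_{x\to+\infty}u(x)=0,$$ i.e. $u\in H^1(\Lambda)$ and $A_{\gamma,\mu}(u,v)=(f,v)+\eta v(0)$ for all $v\in H^1(\Lambda)$. Let $u_N\in X^{\beta}_N$ be the solution of the generalized Laguerre spectral scheme $A_{\gamma,\mu}(u_N,v_N)=(f,v_N)+\eta v_N(0)$ for all $v_N\in X^{\beta}_N$. Then both $u$ and $u_N$ have the explicit representations in $\{\mathcal{R}^{\beta}_k\}$ $$u(x)=\sum_{k=0}^{\infty}\hat u_k\,\mathcal{R}^{\beta}_k(x),\qquad u_N(x)=\sum_{k=0}^{N}\hat u_k\,\mathcal{R}^{\beta}_k(x),$$ $$\hat u_k=\frac1{\rho_k}A_{\gamma,\mu}(u,\mathcal{R}^{\beta}_k)=\frac1{\rho_k}\big[(f,\mathcal{R}^{\beta}_k)+\eta\,\mathcal{R}^{\beta}_k(0)\big],\qquad k\ge0.$$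
   Context: $\Lambda=(0,\infty)$ and $\mathbb{N}_0$ is the set of nonnegative integers; $H^1(\Lambda)$ is the usual Sobolev space and $(H^1(\Lambda))'$ its dual; $(\cdot,\cdot)$ is the $L^2(\Lambda)$ inner product, and $(f,v)$ also denotes the duality pairing between $(H^1(\Lambda))'$ and $H^1(\Lambda)$. $X^{\beta}_N=\{e^{-\frac12\beta x}p(x):p\text{ a real polynomial of degree}\le N\}$, with $X^\beta_{-1}=\{0\}$. The bilinear form is $A_{\gamma,\mu}(u,v)=\mu\,u(0)v(0)+(u',v')+\gamma(u,v)$ on $H^1(\Lambda)$. For $a\in\mathbb{R}$ let $(a)_n=a(a+1)\cdots(a+n-1)$, $(a)_0=1$. For $\alpha\in\mathbb{R}$ and $k\in\mathbb{N}_0$, the generalized Laguerre polynomials are $\mathcal{L}^{\alpha}_k(x)=\sum_{\nu=0}^{k}\frac{(\alpha+\nu+1)_{k-\nu}}{(k-\nu)!\,\nu!}(-x)^{\nu}$ and the generalized Laguerre functions are $l^{\alpha,\beta}_k(x)=e^{-\frac12\beta x}\mathcal{L}^{\alpha}_k(\beta x)$. $\mathcal{R}^{\beta}_k\in X^{\beta}_k$, $k\ge0$, are the Sobolev orthogonal Laguerre functions, i.e. the functions with $\mathcal{R}^{\beta}_k-l^{-1,\beta}_k\in X^{\beta}_{k-1}$ and $A_{\gamma,\mu}(\mathcal{R}^{\beta}_k,\mathcal{R}^{\beta}_m)=\rho_k\delta_{k,m}$ for all $k,m\ge0$ (so $\rho_k=A_{\gamma,\mu}(\mathcal{R}^{\beta}_k,\mathcal{R}^{\beta}_k)$),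 where $\delta_{k,m}$ is the Kronecker symbol. *)

theory Defs
  imports "HOL-Analysis.Analysis" "HOL-Computational_Algebra.Polynomial"
begin

text \<open>
  Functions on the half line \<open>\<Lambda> = (0,\<infinity>)\<close> are modelled by total functions \<open>real \<Rightarrow> real\<close>;
  values at negative arguments never matter.
\<close>

abbreviation Lam :: "real set" where
  "Lam \<equiv> {0<..}"

definition L2 :: "(real \<Rightarrow> real) set" where
  "L2 = {u. u \<in> borel_measurable (lebesgue_on Lam) \<and>
            integrable (lebesgue_on Lam) (\<lambda>x. (u x)\<^sup>2)}"

definition L2_inner :: "(real \<Rightarrow> real) \<Rightarrow> (real \<Rightarrow> real) \<Rightarrow> real" where
  "L2_inner u v = (LINT x|lebesgue_on Lam. u x * v x)"

definition test_fun :: "(real \<Rightarrow> real) set" where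
  "test_fun = {\<phi>. (\<forall>n. (deriv ^^ n) \<phi> differentiable_on UNIV) \<and>
                  compact (closure {x. \<phi> x \<noteq> 0}) \<and> closure {x. \<phi> x \<noteq> 0} \<subseteq> Lam}"

definition is_weak_deriv :: "(real \<Rightarrow> real) \<Rightarrow> (real \<Rightarrow> real) \<Rightarrow> bool" where
  "is_weak_deriv u g \<longleftrightarrow> (\<forall>\<phi>\<in>test_fun. L2_inner u (deriv \<phi>) = - L2_inner g \<phi>)"

text \<open>
  Every class in \<open>H\<^sup>1(\<Lambda>)\<close> has exactly one representative that is continuous on \<open>[0,\<infinity>)\<close>,
  and the trace \<open>u(0)\<close> is by definition its value at \<open>0\<close>. The set \<open>H1\<close> consists of these
  continuous representatives, so that \<open>u 0\<close> and \<open>u x\<close> are meaningful.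
\<close>

definition H1 :: "(real \<Rightarrow> real) set" where
  "H1 = {u. continuous_on {0..} u \<and> u \<in> L2 \<and> (\<exists>g\<in>L2. is_weak_deriv u g)}"

text \<open>For \<open>u \<in> H1\<close> the chosen function is determined up to null sets of \<open>\<Lambda>\<close>.\<close>

definition wderiv :: "(real \<Rightarrow> real) \<Rightarrow> real \<Rightarrow> real" where
  "wderiv u = (SOME g. g \<in> L2 \<and> is_weak_deriv u g)"

definition H1_norm :: "(real \<Rightarrow> real) \<Rightarrow> real" where
  "H1_norm u = sqrt (L2_inner u u + L2_inner (wderiv u) (wderiv u))"

text \<open>
  The duality pairing \<open>(f,v)\<close> is the application \<open>f v\<close>. Boundedness forces \<open>f\<close> to agree on
  members of \<open>H1\<close> that differ only at negative arguments; values of \<open>f\<close> outside \<open>H1\<close> are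
  irrelevant.
\<close>

definition H1_dual :: "((real \<Rightarrow> real) \<Rightarrow> real) set" where
  "H1_dual = {f. (\<forall>v\<in>H1. \<forall>w\<in>H1. f (\<lambda>x. v x + w x) = f v + f w) \<and>
                 (\<forall>c. \<forall>v\<in>H1. f (\<lambda>x. c * v x) = c * f v) \<and>
                 (\<exists>C. \<forall>v\<in>H1. \<bar>f v\<bar> \<le> C * H1_norm v)}"

definition robin_form :: "real \<Rightarrow> real \<Rightarrow> (real \<Rightarrow> real) \<Rightarrow> (real \<Rightarrow> real) \<Rightarrow> real" where
  "robin_form \<gamma> \<mu> u v = \<mu> * u 0 * v 0 + L2_inner (wderiv u) (wderiv v) + \<gamma> * L2_inner u v"

text \<open>The index is an integer and \<open>p = 0\<close> is always admitted, so that \<open>X \<beta> (-1) = {\<lambda>x. 0}\<close>.\<close>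

definition X :: "real \<Rightarrow> int \<Rightarrow> (real \<Rightarrow> real) set" where
  "X \<beta> n = {\<lambda>x. exp (- \<beta> * x / 2) * poly p x | p. p = 0 \<or> int (degree p) \<le> n}"

definition gen_laguerre :: "real \<Rightarrow> nat \<Rightarrow> real \<Rightarrow> real" where
  "gen_laguerre \<alpha> k x =
     (\<Sum>\<nu>\<le>k. pochhammer (\<alpha> + real \<nu> + 1) (k - \<nu>) / (fact (k - \<nu>) * fact \<nu>) * (- x) ^ \<nu>)"

definition laguerre_fun :: "real \<Rightarrow> real \<Rightarrow> nat \<Rightarrow> real \<Rightarrow> real" where
  "laguerre_fun \<alpha> \<beta> k x = exp (- \<beta> * x / 2) * gen_laguerre \<alpha> k (\<beta> * x)"

definition sobolev_laguerre ::
  "real \<Rightarrow> real \<Rightarrow> real \<Rightarrow> (nat \<Rightarrow> real \<Rightarrow> real) \<Rightarrow> (nat \<Rightarrow> real) \<Rightarrow> bool" where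
  "sobolev_laguerre \<beta> \<gamma> \<mu> R \<rho> \<longleftrightarrow>
     (\<forall>k. R k \<in> X \<beta> (int k)) \<and>
     (\<forall>k. (\<lambda>x. R k x - laguerre_fun (- 1) \<beta> k x) \<in> X \<beta> (int k - 1)) \<and>
     (\<forall>k m. robin_form \<gamma> \<mu> (R k) (R m) = (if k = m then \<rho> k else 0))"

definition weak_solution ::
  "real \<Rightarrow> real \<Rightarrow> real \<Rightarrow> ((real \<Rightarrow> real) \<Rightarrow> real) \<Rightarrow> (real \<Rightarrow> real) \<Rightarrow> bool" where
  "weak_solution \<gamma> \<mu> \<eta> f u \<longleftrightarrow>
     u \<in> H1 \<and> (\<forall>v\<in>H1. robin_form \<gamma> \<mu> u v = f v + \<eta> * v 0)"

definition scheme_solution ::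
  "real \<Rightarrow> real \<Rightarrow> real \<Rightarrow> real \<Rightarrow> nat \<Rightarrow> ((real \<Rightarrow> real) \<Rightarrow> real) \<Rightarrow> (real \<Rightarrow> real) \<Rightarrow> bool" where
  "scheme_solution \<beta> \<gamma> \<mu> \<eta> N f w \<longleftrightarrow>
     w \<in> X \<beta> (int N) \<and> (\<forall>v\<in>X \<beta> (int N). robin_form \<gamma> \<mu> w v = f v + \<eta> * v 0)"

text \<open>
  The norm induced by the bilinear form. For \<open>\<gamma> > 0\<close> it is equivalent to the \<open>H\<^sup>1\<close> norm. For
  \<open>\<gamma> = 0\<close> it is weaker, and it is the norm in which the orthogonal expansion converges.
\<close>

definition energy_norm :: "real \<Rightarrow> real \<Rightarrow> (real \<Rightarrow> real) \<Rightarrow> real" where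
  "energy_norm \<gamma> \<mu> v = sqrt (robin_form \<gamma> \<mu> v v)"

end

theory Submission
  imports Defs "HOL-Real_Asymp.Real_Asymp"
begin

text \<open>
  The functions \<open>R k\<close> are orthogonal for the Robin form, and because \<open>R k\<close> has exact degree \<open>k\<close>, the
  first \<open>n\<close> of them span all exponential polynomials \<open>exp (- \<beta> * x / 2) * p x\<close> of degree below \<open>n\<close>.
  Testing the weak formulation and the scheme with \<open>R k\<close> therefore identifies the coefficients of
  \<open>u\<close> and \<open>uN\<close>, and the representation of \<open>uN\<close> is plain linear algebra. The substance lies in the
  convergence of the series for \<open>u\<close>.

  Convergence in the energy norm. The partial sums are best approximations, so it suffices that
  the exponential polynomials are dense in \<open>H\<^sup>1\<close>, together with the trace at \<open>0\<close>. Density in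
  \<open>L\<^sup>2\<close> (\<open>expoly_dense_L2\<close>) comes from power series, which pass from one decay rate to another, and
  the Weierstrass theorem in the variable \<open>exp (- \<delta> * x)\<close>. It is lifted to \<open>H\<^sup>1\<close>
  (\<open>expoly_dense_H1\<close>) by the operator \<open>w \<mapsto> w' - w\<close>: it preserves exponential polynomials,
  and integration by parts shows that \<open>\<parallel>w' - w\<parallel>\<^sup>2 = \<parallel>w'\<parallel>\<^sup>2 + \<parallel>w\<parallel>\<^sup>2 + (w 0)\<^sup>2\<close>.

  Pointwise convergence. The energy controls the derivative of the residual \<open>w\<close>, and so it
  controls \<open>w x - w 0\<close>. It controls \<open>w 0\<close> as well if \<open>\<mu> > 0\<close> or \<open>\<gamma> > 0\<close>. In the remaining case
  \<open>\<gamma> = \<mu> = 0\<close> it does not, and convergence of the trace uses that \<open>u\<close> itself is square integrable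
  (\<open>trace_tendsto_0_Neumann\<close>).

  All this rests on calculus for weak derivatives: a continuous representative is a primitive of its
  weak derivative (\<open>weak_deriv_increment\<close>, by testing with smooth approximations of the indicator of
  an interval), weak derivatives are unique (\<open>weak_deriv_unique\<close>), and products can be integrated by
  parts on the whole half line (\<open>H1_integration_by_parts\<close>, by Fubini).
\<close>

section \<open>Semi-inner products and orthogonal families\<close>

text \<open>
  The argument meets three positive semidefinite forms: the \<open>L\<^sup>2\<close> product, the Dirichlet form
  \<open>(u',v')\<close> and the Robin form. None of them separates points, since functions are not
  identified almost everywhere, so they share only the theory of semi-inner products.
\<close>

locale semi_inner =
  fixes V :: "(real \<Rightarrow> real) set" and B :: "(real \<Rightarrow> real) \<Rightarrow> (real \<Rightarrow> real) \<Rightarrow> real"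
  assumes zero_mem: "(\<lambda>x. 0) \<in> V"
    and add_mem: "\<lbrakk>u \<in> V; v \<in> V\<rbrakk> \<Longrightarrow> (\<lambda>x. u x + v x) \<in> V"
    and scale_mem: "u \<in> V \<Longrightarrow> (\<lambda>x. c * u x) \<in> V"
    and commute: "B u v = B v u"
    and add_left: "\<lbrakk>u \<in> V; v \<in> V; w \<in> V\<rbrakk> \<Longrightarrow> B (\<lambda>x. u x + v x) w = B u w + B v w"
    and scale_left: "\<lbrakk>u \<in> V; w \<in> V\<rbrakk> \<Longrightarrow> B (\<lambda>x. c * u x) w = c * B u w"
    and nonneg: "u \<in> V \<Longrightarrow> 0 \<le> B u u"
begin

lemma diff_mem: "\<lbrakk>u \<in> V; v \<in> V\<rbrakk> \<Longrightarrow> (\<lambda>x. u x - v x) \<in> V"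
  using add_mem[OF _ scale_mem[of v "-1"], of u] by simp

lemma diff_left: "\<lbrakk>u \<in> V; v \<in> V; w \<in> V\<rbrakk> \<Longrightarrow> B (\<lambda>x. u x - v x) w = B u w - B v w"
  using add_left[OF _ scale_mem[of v "-1"], of u w] scale_left[of v w "-1"] by simp

lemma diff_right: "\<lbrakk>u \<in> V; v \<in> V; w \<in> V\<rbrakk> \<Longrightarrow> B w (\<lambda>x. u x - v x) = B w u - B w v"
  by (simp add: commute[of w] diff_left)

lemma sum_mem: "(\<And>k. k \<in> I \<Longrightarrow> w k \<in> V) \<Longrightarrow> (\<lambda>x. \<Sum>k\<in>I. c k * w k x) \<in> V"
proof (induction I rule: infinite_finite_induct)
  case (insert i I)
  then show ?case
    using add_mem[OF scale_mem[of "w i" "c i"], of "\<lambda>x. \<Sum>k\<in>I. c k * w k x"] by simp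
qed (simp_all add: zero_mem)

lemma zero_left: "w \<in> V \<Longrightarrow> B (\<lambda>x. 0) w = 0"
  using scale_left[OF zero_mem, of w 0] by simp

lemma sum_left:
  "\<lbrakk>\<And>k. k \<in> I \<Longrightarrow> w k \<in> V; v \<in> V\<rbrakk> \<Longrightarrow>
    B (\<lambda>x. \<Sum>k\<in>I. c k * w k x) v = (\<Sum>k\<in>I. c k * B (w k) v)"
proof (induction I rule: infinite_finite_induct)
  case (insert i I)
  then have mem: "w i \<in> V" "\<And>k. k \<in> I \<Longrightarrow> w k \<in> V" by auto
  have "B (\<lambda>x. c i * w i x + (\<Sum>k\<in>I. c k * w k x)) v =
      B (\<lambda>x. c i * w i x) v + B (\<lambda>x. \<Sum>k\<in>I. c k * w k x) v"
    using mem insert.prems(2) by (intro add_left scale_mem sum_mem)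
  also have "B (\<lambda>x. c i * w i x) v = c i * B (w i) v"
    using mem(1) insert.prems(2) by (rule scale_left)
  also have "B (\<lambda>x. \<Sum>k\<in>I. c k * w k x) v = (\<Sum>k\<in>I. c k * B (w k) v)"
    using mem(2) insert.prems(2) by (rule insert.IH)
  finally show ?case using insert.hyps by simp
qed (simp_all add: zero_left)

lemma norm_diff:
  assumes "u \<in> V" "v \<in> V"
  shows "B (\<lambda>x. u x - v x) (\<lambda>x. u x - v x) = B u u - 2 * B u v + B v v"
  using diff_left[OF assms diff_mem[OF assms]] diff_right[OF assms assms(1)]
    diff_right[OF assms assms(2)] commute[of v u] by linarith

lemma norm_add_le:
  assumes "u \<in> V" "v \<in> V"
  shows "B (\<lambda>x. u x + v x) (\<lambda>x. u x + v x) \<le> 2 * B u u + 2 * B v v"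
proof -
  let ?w = "\<lambda>x. u x + v x"
  have "B ?w ?w = B u u + 2 * B u v + B v v"
    using add_left[OF assms add_mem[OF assms]] add_left[OF assms assms(1)] add_left[OF assms assms(2)]
      commute[of u v] commute[of u ?w] commute[of v ?w] by linarith
  then show ?thesis
    using nonneg[OF diff_mem[OF assms]] norm_diff[OF assms] by linarith
qed

lemma Cauchy_Schwarz:
  assumes "u \<in> V" "v \<in> V"
  shows "(B u v)\<^sup>2 \<le> B u u * B v v"
proof -
  have *: "0 \<le> B u u - 2 * t * B u v + t\<^sup>2 * B v v" for t
  proof -
    let ?w = "\<lambda>x. t * v x"
    have w: "?w \<in> V" by (rule scale_mem[OF assms(2)])
    have "B ?w u = t * B u v" "B ?w ?w = t * B v ?w" "B ?w v = t * B v v"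
      using scale_left[OF assms(2)] assms w commute[of v u] by metis+
    then have "B u ?w = t * B u v" "B ?w ?w = t\<^sup>2 * B v v"
      using commute[of u ?w] commute[of v ?w] by (simp_all only: power2_eq_square mult.assoc)
    then show ?thesis
      using nonneg[OF diff_mem[OF assms(1) w]] norm_diff[OF assms(1) w] by (simp only: mult.assoc)
  qed
  show ?thesis
  proof (cases "B v v = 0")
    case True
    have "B u v = 0"
    proof (rule ccontr)
      assume "B u v \<noteq> 0"
      then show False
        using *[of "(B u u + 1) / (2 * B u v)"] True by (simp add: field_simps)
    qed
    then show ?thesis using True by simp
  next
    case False
    then have pos: "B v v > 0" using nonneg[OF assms(2)] by simp
    \<comment> \<open>the minimum of the quadratic in \<open>t\<close>\<close>
    have "0 \<le> B u u - (B u v)\<^sup>2 / B v v"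
      using *[of "B u v / B v v"] False by (simp add: power2_eq_square field_simps)
    then show ?thesis using pos by (simp add: field_simps)
  qed
qed

end

locale orthogonal_family = semi_inner +
  fixes R :: "nat \<Rightarrow> real \<Rightarrow> real" and \<rho> :: "nat \<Rightarrow> real"
  assumes mem: "R k \<in> V" and orth: "B (R k) (R m) = (if k = m then \<rho> k else 0)"
    and pos: "\<rho> k > 0"
begin

definition partial :: "(real \<Rightarrow> real) \<Rightarrow> nat \<Rightarrow> real \<Rightarrow> real" where
  "partial g n = (\<lambda>x. \<Sum>k<n. (B g (R k) / \<rho> k) * R k x)"

lemma partial_mem: "partial g n \<in> V"
  unfolding partial_def by (intro sum_mem mem)

lemma combination_coeff: "k \<in> I \<Longrightarrow> finite I \<Longrightarrow> B (\<lambda>x. \<Sum>j\<in>I. c j * R j x) (R k) = c k * \<rho> k"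
  by (simp add: sum_left mem orth if_distrib cong: if_cong)

lemma residual_orth:
  assumes "g \<in> V" "k < n"
  shows "B (\<lambda>x. g x - partial g n x) (R k) = 0"
proof -
  have "B (partial g n) (R k) = B g (R k) / \<rho> k * \<rho> k"
    unfolding partial_def using assms(2) by (intro combination_coeff) auto
  then show ?thesis
    using diff_left[OF assms(1) partial_mem mem, of g n k] pos[of k] by simp
qed

lemma residual_orth_combination:
  assumes "g \<in> V"
  shows "B (\<lambda>x. g x - partial g n x) (\<lambda>x. \<Sum>k<n. d k * R k x) = 0"
  by (subst commute, subst sum_left)
    (use assms residual_orth[OF assms] in \<open>auto intro!: mem diff_mem partial_mem sum.neutral simp: commute[of "R _"]\<close>)

lemma residual_norm:
  assumes "g \<in> V"
  shows "B (\<lambda>x. g x - partial g n x) (\<lambda>x. g x - partial g n x) =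
    B g g - (\<Sum>k<n. (B g (R k))\<^sup>2 / \<rho> k)"
proof -
  have 1: "B (\<lambda>x. g x - partial g n x) (partial g n) = 0"
    using residual_orth_combination[OF assms, of n "\<lambda>k. B g (R k) / \<rho> k"] by (simp only: partial_def)
  have 2: "B (partial g n) g = (\<Sum>k<n. (B g (R k))\<^sup>2 / \<rho> k)"
    unfolding partial_def
    by (subst sum_left) (auto intro: mem assms simp: commute[of "R _" g] power2_eq_square)
  show ?thesis
    using diff_left[OF assms partial_mem diff_mem[OF assms partial_mem], of g n g n]
      diff_right[OF assms partial_mem assms, of g n] 1 2
      commute[of "partial g n" g] commute[of "partial g n" "\<lambda>x. g x - partial g n x"] by linarith
qed

text \<open>
  Bessel's inequality in the form that is used: the residual norm is nonnegative, so the
  squared normalized coefficients are summable.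
\<close>

lemma normalized_coeff_tendsto_0:
  assumes "g \<in> V"
  shows "(\<lambda>k. (B g (R k))\<^sup>2 / \<rho> k) \<longlonglongrightarrow> 0"
proof (rule summable_LIMSEQ_zero, rule bounded_imp_summable)
  show "0 \<le> (B g (R n))\<^sup>2 / \<rho> n" for n using pos[of n] by simp
  show "(\<Sum>k\<le>n. (B g (R k))\<^sup>2 / \<rho> k) \<le> B g g" for n
    using residual_norm[OF assms, of "Suc n"] nonneg[OF diff_mem[OF assms partial_mem[of g "Suc n"]]]
    by (simp add: lessThan_Suc_atMost)
qed

text \<open>
  The residual is orthogonal to the difference of the two combinations, so Pythagoras applies.
  This is what turns mere density of the span into convergence of the orthogonal expansion.
\<close>

lemma best_approximation:
  assumes "g \<in> V"
  shows "B (\<lambda>x. g x - partial g n x) (\<lambda>x. g x - partial g n x) \<le>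
    B (\<lambda>x. g x - (\<Sum>k<n. d k * R k x)) (\<lambda>x. g x - (\<Sum>k<n. d k * R k x))"
proof -
  define r where "r = (\<lambda>x. g x - partial g n x)"
  define h where "h = (\<lambda>x. \<Sum>k<n. (d k - B g (R k) / \<rho> k) * R k x)"
  have rh: "r \<in> V" "h \<in> V"
    unfolding r_def h_def by (intro diff_mem assms partial_mem, intro sum_mem mem)
  have eq: "(\<lambda>x. g x - (\<Sum>k<n. d k * R k x)) = (\<lambda>x. r x - h x)"
    unfolding r_def h_def partial_def by (simp add: left_diff_distrib sum_subtractf)
  have "B r h = 0"
    unfolding r_def h_def by (rule residual_orth_combination[OF assms])
  then have "B (\<lambda>x. r x - h x) (\<lambda>x. r x - h x) = B r r + B h h"
    using norm_diff[OF rh] by simp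
  then show ?thesis
    using nonneg[OF rh(2)] unfolding eq r_def[symmetric] by simp
qed

end

section \<open>Square integrable functions on the half line\<close>

lemma L2I: "\<lbrakk>u \<in> borel_measurable (lebesgue_on Lam); integrable (lebesgue_on Lam) (\<lambda>x. (u x)\<^sup>2)\<rbrakk> \<Longrightarrow> u \<in> L2"
  by (simp add: L2_def)

lemma L2_measurable: "u \<in> L2 \<Longrightarrow> u \<in> borel_measurable (lebesgue_on Lam)"
  by (simp add: L2_def)

lemma L2_square_integrable: "u \<in> L2 \<Longrightarrow> integrable (lebesgue_on Lam) (\<lambda>x. (u x)\<^sup>2)"
  by (simp add: L2_def)

lemma abs_mult_le_sum_squares: "\<bar>a * b\<bar> \<le> a\<^sup>2 + (b\<^sup>2 :: real)"
proof -
  have "\<bar>a * b\<bar> = \<bar>a\<bar> * \<bar>b\<bar>" by (simp add: abs_mult)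
  also have "\<dots> \<le> (\<bar>a\<bar>\<^sup>2 + \<bar>b\<bar>\<^sup>2)"
    using zero_le_power2[of "\<bar>a\<bar> - \<bar>b\<bar>"] mult_nonneg_nonneg[of "\<bar>a\<bar>" "\<bar>b\<bar>"]
    unfolding power2_diff by linarith
  finally show ?thesis by simp
qed

lemma L2_mult_integrable:
  assumes "u \<in> L2" "v \<in> L2"
  shows "integrable (lebesgue_on Lam) (\<lambda>x. u x * v x)"
proof (rule Bochner_Integration.integrable_bound)
  show "integrable (lebesgue_on Lam) (\<lambda>x. (u x)\<^sup>2 + (v x)\<^sup>2)"
    using assms by (intro Bochner_Integration.integrable_add L2_square_integrable)
  show "(\<lambda>x. u x * v x) \<in> borel_measurable (lebesgue_on Lam)"
    using assms[THEN L2_measurable] by simp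
qed (use abs_mult_le_sum_squares in auto)

lemma L2_bounded:
  assumes "f \<in> borel_measurable (lebesgue_on Lam)" "g \<in> L2" "AE x in lebesgue_on Lam. \<bar>f x\<bar> \<le> g x"
  shows "f \<in> L2"
proof (rule L2I)
  show "integrable (lebesgue_on Lam) (\<lambda>x. (f x)\<^sup>2)"
  proof (rule Bochner_Integration.integrable_bound)
    show "integrable (lebesgue_on Lam) (\<lambda>x. (g x)\<^sup>2)" by (rule L2_square_integrable[OF assms(2)])
    show "AE x in lebesgue_on Lam. norm ((f x)\<^sup>2) \<le> norm ((g x)\<^sup>2)"
      using assms(3) by eventually_elim (simp add: abs_le_square_iff[symmetric])
  qed (use assms(1) in simp)
qed fact

lemma L2_zero: "(\<lambda>x. 0) \<in> L2"
  by (simp add: L2_def)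

lemma L2_add:
  assumes "u \<in> L2" "v \<in> L2"
  shows "(\<lambda>x. u x + v x) \<in> L2"
proof (rule L2I)
  have "(\<lambda>x. (u x + v x)\<^sup>2) = (\<lambda>x. (u x)\<^sup>2 + (v x)\<^sup>2 + 2 * (u x * v x))"
    by (simp add: power2_sum mult.assoc)
  then show "integrable (lebesgue_on Lam) (\<lambda>x. (u x + v x)\<^sup>2)"
    using assms by (simp add: L2_square_integrable L2_mult_integrable)
qed (use assms[THEN L2_measurable] in simp)

lemma L2_scale: "u \<in> L2 \<Longrightarrow> (\<lambda>x. c * u x) \<in> L2"
  by (auto simp: L2_def power_mult_distrib)

interpretation L2: semi_inner L2 L2_inner
proof
  show "L2_inner u v = L2_inner v u" for u v
    by (simp add: L2_inner_def mult.commute)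
  show "L2_inner (\<lambda>x. u x + v x) w = L2_inner u w + L2_inner v w"
    if "u \<in> L2" "v \<in> L2" "w \<in> L2" for u v w
    using that by (simp add: L2_inner_def distrib_right L2_mult_integrable)
  show "L2_inner (\<lambda>x. c * u x) w = c * L2_inner u w" if "u \<in> L2" "w \<in> L2" for u w c
    using that by (simp add: L2_inner_def mult.assoc)
  show "0 \<le> L2_inner u u" for u
    by (simp add: L2_inner_def)
qed (auto intro: L2_zero L2_add L2_scale)

lemma L2_inner_cong_AE:
  assumes "AE x in lebesgue_on Lam. u x = u' x"
    and "u \<in> L2" "u' \<in> L2" "v \<in> L2"
  shows "L2_inner u v = L2_inner u' v"
  unfolding L2_inner_def
  using assms(1) by (intro integral_cong_AE) (auto intro!: borel_measurable_times assms(2-)[THEN L2_measurable])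

lemma L2_inner_self_eq_0:
  assumes "u \<in> L2" "L2_inner u u = 0"
  shows "AE x in lebesgue_on Lam. u x = 0"
proof -
  have "AE x in lebesgue_on Lam. u x * u x = 0"
    using assms(2) unfolding L2_inner_def
    by (subst (asm) integral_nonneg_eq_0_iff_AE) (auto intro: L2_mult_integrable assms(1))
  then show ?thesis by eventually_elim simp
qed

lemma borel_measurable_lebesgue_on_Lam:
  "f \<in> borel_measurable borel \<Longrightarrow> f \<in> borel_measurable (lebesgue_on Lam)"
  by (intro measurable_restrict_space1 measurable_completion) simp

lemma interval_indicator_L2: "indicator {a<..b} \<in> L2"
proof (rule L2I)
  have "integrable lebesgue (indicator (Lam \<inter> {a<..b}) :: real \<Rightarrow> real)"
    by (rule integrable_real_indicator)
      (use emeasure_bounded_finite[of "Lam \<inter> {a<..b}"] bounded_subset[of "{a<..b}" "Lam \<inter> {a<..b}"] in auto)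
  then have "integrable (lebesgue_on Lam) (indicator {a<..b} :: real \<Rightarrow> real)"
    by (simp add: integrable_restrict_space flip: indicator_inter_arith)
  moreover have "(\<lambda>x. (indicator {a<..b} x :: real)\<^sup>2) = indicator {a<..b}"
    by (auto simp: indicator_def)
  ultimately show "integrable (lebesgue_on Lam) (\<lambda>x. (indicator {a<..b} x :: real)\<^sup>2)" by simp
qed (rule borel_measurable_lebesgue_on_Lam, simp)

text \<open>
  A monotone class theorem for \<open>L\<^sup>2\<close>. It serves twice: with the orthogonal complement of a
  function as \<open>C\<close> it gives uniqueness of weak derivatives, and with the closure of the exponential
  polynomials as \<open>C\<close> it gives completeness of the Laguerre system. Indicators of intervals lead to
  those of bounded Borel sets by Dynkin's lemma, these to simple functions by linearity, and these to
  all of \<open>L\<^sup>2\<close> by dominated limits. Since limits are taken almost everywhere, Lebesgue measurable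
  functions need no separate treatment.
\<close>

theorem L2_closed_subspace_eq:
  assumes sub: "C \<subseteq> L2"
    and add: "\<And>u v. \<lbrakk>u \<in> C; v \<in> C\<rbrakk> \<Longrightarrow> (\<lambda>x. u x + v x) \<in> C"
    and scale: "\<And>c u. u \<in> C \<Longrightarrow> (\<lambda>x. c * u x) \<in> C"
    and lim: "\<And>s g f. \<lbrakk>\<And>n. s n \<in> C; f \<in> L2; g \<in> L2;
        AE x in lebesgue_on Lam. (\<lambda>n. s n x) \<longlonglongrightarrow> f x;
        \<And>n. AE x in lebesgue_on Lam. \<bar>s n x\<bar> \<le> g x\<rbrakk> \<Longrightarrow> f \<in> C"
    and interval: "\<And>a b. \<lbrakk>0 < a; a < b\<rbrakk> \<Longrightarrow> indicator {a<..b} \<in> C"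
  shows "C = L2"
proof -
  have interval0: "indicator {0<..b} \<in> C" if "0 < b" for b :: real
  proof (rule lim)
    show "indicator {b / (real n + 2)<..b} \<in> C" for n
      using that mult_nonneg_nonneg[of b "real n"]
      by (intro interval) (auto simp: field_simps intro: less_le_trans[of 0 b])
    show "AE x in lebesgue_on Lam. (\<lambda>n. indicator {b / (real n + 2)<..b} x) \<longlonglongrightarrow> (indicator {0<..b} x :: real)"
    proof (rule AE_I2)
      fix x :: real assume "x \<in> space (lebesgue_on Lam)"
      then have x: "0 < x" by simp
      have "(\<lambda>n. b / (real n + 2)) \<longlonglongrightarrow> 0" by real_asymp
      then have "\<forall>\<^sub>F n in sequentially. b / (real n + 2) < x"
        using x by (rule order_tendstoD)
      then have "\<forall>\<^sub>F n in sequentially. indicator {b / (real n + 2)<..b} x = (indicator {0<..b} x :: real)"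
        by eventually_elim (use x in \<open>auto simp: indicator_def\<close>)
      then show "(\<lambda>n. indicator {b / (real n + 2)<..b} x) \<longlonglongrightarrow> (indicator {0<..b} x :: real)"
        by (rule tendsto_eventually)
    qed
    show "AE x in lebesgue_on Lam. \<bar>indicator {b / (real n + 2)<..b} x\<bar> \<le> (indicator {0<..b} x :: real)" for n
      using that by (intro AE_I2) (auto simp: indicator_def field_simps)
  qed (rule interval_indicator_L2)+
  have zero: "(\<lambda>x. 0) \<in> C"
    using scale[OF interval0[of 1], of 0] by simp
  \<comment> \<open>Dynkin's lemma is applied inside \<open>(0,m]\<close>, because complements must stay square integrable\<close>
  have borel: "indicator (A \<inter> {0<..m}) \<in> C" if A: "A \<in> sets borel" and m: "0 < m" for A and m :: real
  proof -
    have dom: "AE x in lebesgue_on Lam. \<bar>indicator (A \<inter> {0<..m}) x\<bar> \<le> (indicator {0<..m} x :: real)" for A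
      by (intro AE_I2) (auto simp: indicator_def)
    have inL2: "indicator (A \<inter> {0<..m}) \<in> L2" if "A \<in> sets borel" for A
      using that by (intro L2_bounded[OF _ interval_indicator_L2 dom] borel_measurable_lebesgue_on_Lam) auto
    have "Int_stable (range (\<lambda>a. {..a::real}))" "range (\<lambda>a. {..a::real}) \<subseteq> Pow UNIV"
      by (auto simp: Int_stable_def)
    moreover have "A \<in> sigma_sets UNIV (range (\<lambda>a. {..a::real}))"
      using A unfolding borel_eq_atMost by simp
    ultimately show ?thesis
    proof (induction rule: sigma_sets_induct_disjoint)
      case (basic A)
      then obtain a where A: "A = {..a}" by auto
      show ?case
      proof (cases "0 < a")
        case True
        then have "A \<inter> {0<..m} = {0<..min a m}" using A by auto
        then show ?thesis using interval0[of "min a m"] True m by simp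
      next
        case False
        then have "A \<inter> {0<..m} = {}" using A by auto
        then show ?thesis using zero by (simp add: indicator_def)
      qed
    next
      case empty
      then show ?case using zero by (simp add: indicator_def)
    next
      case (compl A)
      have "indicator ((UNIV - A) \<inter> {0<..m}) =
          (\<lambda>x. indicator {0<..m} x + (-1) * indicator (A \<inter> {0<..m}) x :: real)"
        by (auto simp: indicator_def)
      then show ?case
        using add[OF interval0[OF m] scale[OF compl.IH, of "-1"]] by (simp only:)
    next
      case (union A)
      have Asets: "A i \<in> sets borel" for i
      proof -
        have "A i \<in> sigma_sets UNIV (range (\<lambda>a. {..a::real}))" using union.hyps(2) by blast
        then show ?thesis unfolding borel_eq_atMost by simp
      qed
      have fin: "indicator ((\<Union>i<n. A i) \<inter> {0<..m}) \<in> C" for n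
      proof (induction n)
        case 0
        then show ?case using zero by (simp add: indicator_def)
      next
        case (Suc n)
        have "A n \<inter> A i = {}" if "i < n" for i
          using union.hyps(1) that by (intro disjoint_family_onD[of A UNIV]) auto
        then have disj: "(\<Union>i<n. A i) \<inter> {0<..m} \<inter> (A n \<inter> {0<..m}) = {}" by blast
        have "(\<Union>i<Suc n. A i) \<inter> {0<..m} = (\<Union>i<n. A i) \<inter> {0<..m} \<union> A n \<inter> {0<..m}"
          by (simp only: lessThan_Suc UN_insert) blast
        then have "indicator ((\<Union>i<Suc n. A i) \<inter> {0<..m}) =
            (\<lambda>x. indicator ((\<Union>i<n. A i) \<inter> {0<..m}) x + indicator (A n \<inter> {0<..m}) x :: real)"
          using disj by (intro ext) (simp only: indicator_disj_union)
        then show ?case using add[OF Suc union.IH[of n]] by (simp only:)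
      qed
      show ?case
      proof (rule lim[OF fin])
        show "indicator (\<Union> (range A) \<inter> {0<..m}) \<in> L2"
          using Asets by (intro inL2) auto
        show "AE x in lebesgue_on Lam. (\<lambda>n. indicator ((\<Union>i<n. A i) \<inter> {0<..m}) x)
            \<longlonglongrightarrow> (indicator (\<Union> (range A) \<inter> {0<..m}) x :: real)"
        proof (rule AE_I2, rule tendsto_eventually)
          fix x
          show "\<forall>\<^sub>F n in sequentially. indicator ((\<Union>i<n. A i) \<inter> {0<..m}) x =
              (indicator (\<Union> (range A) \<inter> {0<..m}) x :: real)"
          proof (cases "\<exists>i. x \<in> A i")
            case True
            then obtain i where "x \<in> A i" by auto
            then show ?thesis
              by (intro eventually_sequentiallyI[of "Suc i"]) (auto simp: indicator_def)
          qed (auto simp: indicator_def)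
        qed
      qed (rule interval_indicator_L2 dom)+
    qed
  qed
  have "u \<in> C" if u: "u \<in> L2" for u
  proof -
    \<comment> \<open>replace \<open>u\<close> by a Borel function, whose simple approximations have Borel level sets\<close>
    have "(\<lambda>x. indicator Lam x * u x) \<in> borel_measurable lebesgue"
      using L2_measurable[OF u] by (simp add: borel_measurable_restrict_space_iff)
    then obtain w where w: "w \<in> borel_measurable lborel" "AE x in lborel. indicator Lam x * u x = w x"
      using completion_ex_borel_measurable_real by blast
    have uw: "AE x in lebesgue_on Lam. w x = u x"
      using AE_completion[OF w(2)] by (subst AE_restrict_space_iff) (auto simp: indicator_def)
    obtain s where s: "\<And>i. simple_function lborel (s i)" "\<And>x. (\<lambda>i. s i x) \<longlonglongrightarrow> w x"
      "\<And>i x. dist (s i x) 0 \<le> 2 * dist (w x) 0"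
      using borel_measurable_implies_sequence_metric[OF w(1), of 0] by auto
    have simple: "(\<lambda>x. indicator {0<..real i + 1} x * s i x) \<in> C" for i
    proof -
      define T where "T y = s i -` {y} \<inter> {0<..real i + 1}" for y
      have fin: "finite (range (s i))" using simple_functionD(1)[OF s(1)[of i]] by simp
      have mem: "(\<lambda>x. \<Sum>y\<in>Y. y * indicator (T y) x) \<in> C" if "finite Y" for Y
        using that
      proof (induction Y rule: finite_induct)
        case (insert y Y)
        have "indicator (T y) \<in> C"
          unfolding T_def using simple_functionD(2)[OF s(1)[of i], of "{y}"] by (intro borel) auto
        from add[OF scale[OF this, of y] insert.IH] show ?case
          using insert.hyps by (simp only: sum.insert not_False_eq_True)
      qed (simp add: zero)
      have "indicator {0<..real i + 1} x * s i x = (\<Sum>y\<in>range (s i). y * indicator (T y) x)" for x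
      proof -
        have "(\<Sum>y\<in>range (s i). y * indicator (T y) x) =
            (\<Sum>y\<in>range (s i). if y = s i x then indicator {0<..real i + 1} x * s i x else 0)"
          by (intro sum.cong) (auto simp: T_def indicator_def)
        then show ?thesis using fin by simp
      qed
      then show ?thesis using mem[OF fin] by (simp only:)
    qed
    show ?thesis
    proof (rule lim[OF simple u])
      show "(\<lambda>x. 2 * \<bar>u x\<bar>) \<in> L2"
        using L2_scale[of "\<lambda>x. \<bar>u x\<bar>" 2] u by (auto simp: L2_def)
      show "AE x in lebesgue_on Lam. (\<lambda>n. indicator {0<..real n + 1} x * s n x) \<longlonglongrightarrow> u x"
        using uw AE_space
      proof eventually_elim
        case (elim x)
        then have x: "0 < x" by simp
        have "\<forall>\<^sub>F n in sequentially. x < real n + 1" by real_asymp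
        then have "\<forall>\<^sub>F n in sequentially. s n x = indicator {0<..real n + 1} x * s n x"
          by eventually_elim (use x in \<open>auto simp: indicator_def\<close>)
        with s(2)[of x] elim(1) show ?case
          using Lim_transform_eventually by force
      qed
      show "AE x in lebesgue_on Lam. \<bar>indicator {0<..real n + 1} x * s n x\<bar> \<le> 2 * \<bar>u x\<bar>" for n
        using uw
      proof eventually_elim
        case (elim x)
        have "\<bar>indicator {0<..real n + 1} x * s n x\<bar> \<le> \<bar>s n x\<bar>" by (simp add: indicator_def)
        also have "\<dots> \<le> 2 * \<bar>u x\<bar>" using s(3)[of n x] elim by simp
        finally show ?case .
      qed
    qed
  qed
  then show ?thesis using sub by blast
qed

section \<open>Smooth bump functions\<close>

text \<open>
  For \<open>p = 1\<close> this is the standard function that is smooth but not analytic at \<open>0\<close>. With a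
  polynomial in \<open>1 / x\<close> as an extra factor, the family becomes closed under differentiation.
\<close>

definition flat :: "real poly \<Rightarrow> real \<Rightarrow> real" where
  "flat p x = (if 0 < x then poly p (1 / x) * exp (- (1 / x)) else 0)"

lemma poly_times_exp_minus_tendsto_0: "((\<lambda>t::real. poly p t * exp (- t)) \<longlongrightarrow> 0) at_top"
proof -
  have "((\<lambda>t. \<Sum>i\<le>degree p. coeff p i * (t ^ i / exp t)) \<longlongrightarrow> (\<Sum>i\<le>degree p. coeff p i * 0)) at_top"
    by (intro tendsto_intros tendsto_power_div_exp_0)
  then show ?thesis
    by (simp add: poly_altdef exp_minus sum_distrib_right divide_inverse mult.assoc)
qed

lemma flat_tendsto_0: "(flat p \<longlongrightarrow> 0) (at 0)"
proof (rule filterlim_split_at)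
  show "(flat p \<longlongrightarrow> 0) (at_left 0)"
    by (rule tendsto_eventually) (auto simp: flat_def eventually_at_filter)
  have "((\<lambda>x::real. poly p (1 / x) * exp (- (1 / x))) \<longlongrightarrow> 0) (at_right 0)"
    using filterlim_compose[OF poly_times_exp_minus_tendsto_0 filterlim_inverse_at_top_right]
    by (simp add: inverse_eq_divide)
  then show "(flat p \<longlongrightarrow> 0) (at_right 0)"
    by (rule Lim_transform_eventually) (auto simp: flat_def eventually_at_filter)
qed

lemma flat_has_derivative:
  "(flat p has_real_derivative flat (monom 1 2 * (p - pderiv p)) x) (at x)"
proof -
  consider "x > 0" | "x < 0" | "x = 0" by linarith
  then show ?thesis
  proof cases
    case 1
    have "((\<lambda>x. poly p (1 / x) * exp (- (1 / x))) has_real_derivative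
        flat (monom 1 2 * (p - pderiv p)) x) (at x)"
      using 1 by (auto intro!: derivative_eq_intros DERIV_chain2[OF poly_DERIV]
          simp: flat_def poly_monom field_simps power2_eq_square)
    then show ?thesis
      by (rule has_field_derivative_transform_within_open[of _ _ _ "{0<..}"])
        (use 1 in \<open>auto simp: flat_def\<close>)
  next
    case 2
    have "((\<lambda>x. 0) has_real_derivative flat (monom 1 2 * (p - pderiv p)) x) (at x)"
      using 2 by (simp add: flat_def)
    then show ?thesis
      by (rule has_field_derivative_transform_within_open[of _ _ _ "{..<0}"])
        (use 2 in \<open>auto simp: flat_def\<close>)
  next
    case 3
    \<comment> \<open>the difference quotient at \<open>0\<close> is again a function of the family, namely \<open>flat (pCons 0 p)\<close>\<close>
    have "((\<lambda>h. (flat p (0 + h) - flat p 0) / h) \<longlongrightarrow> 0) (at 0)"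
      by (rule Lim_transform_eventually[OF flat_tendsto_0[of "pCons 0 p"]])
        (auto simp: flat_def eventually_at_filter)
    then show ?thesis
      using 3 by (simp add: DERIV_def flat_def)
  qed
qed

text \<open>
  An algebra of functions that contains the bumps needed below and is closed under
  differentiation; all its members are therefore smooth.
\<close>

inductive_set flat_alg :: "(real \<Rightarrow> real) set" where
  flat: "(\<lambda>x. flat p (c * x + d)) \<in> flat_alg"
| const: "(\<lambda>x. c) \<in> flat_alg"
| add: "\<lbrakk>f \<in> flat_alg; g \<in> flat_alg\<rbrakk> \<Longrightarrow> (\<lambda>x. f x + g x) \<in> flat_alg"
| mult: "\<lbrakk>f \<in> flat_alg; g \<in> flat_alg\<rbrakk> \<Longrightarrow> (\<lambda>x. f x * g x) \<in> flat_alg"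

lemma flat_alg_affine: "f \<in> flat_alg \<Longrightarrow> (\<lambda>x. f (c * x + d)) \<in> flat_alg"
proof (induction rule: flat_alg.induct)
  case (flat p c' d')
  have "(\<lambda>x. flat p (c' * (c * x + d) + d')) = (\<lambda>x. flat p ((c' * c) * x + (c' * d + d')))"
    by (simp add: algebra_simps)
  then show ?case by (simp only: flat_alg.flat)
qed (auto intro: flat_alg.intros)

lemma flat_alg_has_derivative:
  "f \<in> flat_alg \<Longrightarrow> \<exists>g\<in>flat_alg. \<forall>x. (f has_real_derivative g x) (at x)"
proof (induction rule: flat_alg.induct)
  case (flat p c d)
  have "((\<lambda>x. flat p (c * x + d)) has_real_derivative
      flat (monom 1 2 * (p - pderiv p)) (c * x + d) * c) (at x)" for x
    by (rule DERIV_chain2[OF flat_has_derivative]) (auto intro!: derivative_eq_intros)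
  moreover have "(\<lambda>x. flat (monom 1 2 * (p - pderiv p)) (c * x + d) * c) \<in> flat_alg"
    by (intro flat_alg.intros)
  ultimately show ?case by (intro bexI allI)
next
  case (const c)
  have "((\<lambda>x. c) has_real_derivative 0) (at x)" for x by simp
  then show ?case by (intro bexI[OF _ flat_alg.const[of 0]] allI)
next
  case (add f g)
  then obtain f' g' where "f' \<in> flat_alg" "\<And>x. (f has_real_derivative f' x) (at x)"
    "g' \<in> flat_alg" "\<And>x. (g has_real_derivative g' x) (at x)" by blast
  then show ?case
    by (intro bexI[of _ "\<lambda>x. f' x + g' x"] allI DERIV_add flat_alg.add)
next
  case (mult f g)
  then obtain f' g' where "f' \<in> flat_alg" "\<And>x. (f has_real_derivative f' x) (at x)"
    "g' \<in> flat_alg" "\<And>x. (g has_real_derivative g' x) (at x)" by blast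
  then show ?case
    using mult.hyps
    by (intro bexI[of _ "\<lambda>x. f' x * g x + g' x * f x"] allI DERIV_mult flat_alg.add flat_alg.mult)
qed

lemma flat_alg_deriv: "f \<in> flat_alg \<Longrightarrow> deriv f \<in> flat_alg"
  using flat_alg_has_derivative[of f] DERIV_imp_deriv[of f] by (metis ext)

lemma flat_alg_iterated_deriv: "f \<in> flat_alg \<Longrightarrow> (deriv ^^ n) f \<in> flat_alg"
  by (induction n) (auto intro: flat_alg_deriv)

lemma flat_alg_differentiable: "f \<in> flat_alg \<Longrightarrow> f differentiable_on UNIV"
  using flat_alg_has_derivative[of f]
  by (auto simp: differentiable_on_def differentiable_def has_field_derivative_def)

text \<open>
  The step is the normalized antiderivative of the bump that equals
  \<open>exp (- 1 / x) * exp (- 1 / (1 - x))\<close> on \<open>(0,1)\<close> and vanishes elsewhere.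
\<close>

lemma smooth_step_exists:
  obtains s s' :: "real \<Rightarrow> real"
  where "s' \<in> flat_alg" "\<And>x. (s has_real_derivative s' x) (at x)"
    "\<And>x. 0 \<le> s' x" "\<And>x. x \<notin> {0..1} \<Longrightarrow> s' x = 0"
    "\<And>x. x \<le> 0 \<Longrightarrow> s x = 0" "\<And>x. 1 \<le> x \<Longrightarrow> s x = 1" "\<And>x. 0 \<le> s x" "\<And>x. s x \<le> 1"
proof -
  define b where "b = (\<lambda>x. flat 1 (1 * x + 0) * flat 1 (-1 * x + 1))"
  \<comment> \<open>starting at \<open>-1\<close> puts \<open>0\<close> into the interior, and \<open>b\<close> vanishes to the left of \<open>0\<close> anyway\<close>
  define F where "F x = integral {-1..x} b" for x
  have b_alg: "b \<in> flat_alg"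
    unfolding b_def by (intro flat_alg.intros)
  have b_nonneg: "0 \<le> b x" for x by (simp add: b_def flat_def)
  have b_pos: "0 < b x" if "0 < x" "x < 1" for x using that by (simp add: b_def flat_def)
  have b_zero: "b x = 0" if "x \<le> 0 \<or> 1 \<le> x" for x using that by (auto simp: b_def flat_def)
  have cont: "continuous_on A b" for A
    using flat_alg_differentiable[OF b_alg] differentiable_imp_continuous_on continuous_on_subset by blast
  have F0: "F x = 0" if "x \<le> 0" for x
  proof -
    have "integral {-1..x} b = integral {-1..x} (\<lambda>_. 0)"
      using that by (intro integral_cong b_zero) auto
    then show ?thesis by (simp add: F_def)
  qed
  have F': "(F has_real_derivative b x) (at x)" for x
  proof (cases "x < 0")
    case True
    have "((\<lambda>x. 0) has_real_derivative b x) (at x)" using b_zero[of x] True by simp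
    then show ?thesis
      by (rule has_field_derivative_transform_within_open[of _ _ _ "{..<0}"]) (use True F0 in auto)
  next
    case False
    then have "(F has_real_derivative b x) (at x within {-1..x+1})"
      unfolding F_def by (intro integral_has_real_derivative cont) auto
    then show ?thesis using False by (subst (asm) at_within_Icc_at) auto
  qed
  have mono: "F x \<le> F y" if "x \<le> y" for x y
    using that F' b_nonneg by (meson DERIV_nonneg_imp_nondecreasing)
  have F1: "0 < F 1"
  proof -
    have "F (1/4) < F (3/4)"
      by (rule DERIV_pos_imp_increasing) (use F' b_pos in \<open>auto intro!: exI[of _ "b _"]\<close>)
    then show ?thesis using mono[of 0 "1/4"] mono[of "3/4" 1] F0[of 0] by linarith
  qed
  have F_const: "F x = F 1" if "1 \<le> x" for x
  proof (cases "x = 1")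
    case False
    with that have "1 < x" by simp
    then obtain z where "1 < z" "F x - F 1 = (x - 1) * b z"
      using MVT2[of 1 x F b] F' by blast
    then show ?thesis using b_zero[of z] by simp
  qed simp
  show ?thesis
  proof
    show "(\<lambda>x. 1 / F 1 * b x) \<in> flat_alg" by (intro flat_alg.intros b_alg)
    show "((\<lambda>x. 1 / F 1 * F x) has_real_derivative 1 / F 1 * b x) (at x)" for x
      by (intro DERIV_cmult F')
    show "0 \<le> 1 / F 1 * b x" for x using F1 b_nonneg by simp
    show "1 / F 1 * b x = 0" if "x \<notin> {0..1}" for x using b_zero[of x] that by auto
    show "1 / F 1 * F x = 0" if "x \<le> 0" for x using F0[OF that] by simp
    show "1 / F 1 * F x = 1" if "1 \<le> x" for x using F_const[OF that] F1 by simp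
    show "0 \<le> 1 / F 1 * F x" for x
      using F1 mono[of 0 x] F0[of 0] F0[of x] by (cases "x \<le> 0") auto
    show "1 / F 1 * F x \<le> 1" for x
      using F1 mono[of x 1] F_const[of x] by (cases "x \<le> 1") auto
  qed
qed

section \<open>Test functions and weak derivatives\<close>

lemma integral_Lam_compact_support:
  fixes h :: "real \<Rightarrow> real"
  assumes "0 < p" and "continuous_on {p..q} h" and zero: "\<And>x. x \<notin> {p..q} \<Longrightarrow> h x = 0"
  shows "integrable (lebesgue_on Lam) h" "(LINT x|lebesgue_on Lam. h x) = integral {p..q} h"
proof -
  have int: "integrable (lebesgue_on {p..q}) h"
    using assms(2) by (rule continuous_imp_integrable_real)
  have eq: "(\<lambda>x. indicator Lam x *\<^sub>R h x) = (\<lambda>x. indicator {p..q} x *\<^sub>R h x)"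
    using zero assms(1) by (force simp: indicator_def)
  have "integrable lebesgue (\<lambda>x. indicator {p..q} x *\<^sub>R h x)"
    using int by (subst (asm) integrable_restrict_space) auto
  then show "integrable (lebesgue_on Lam) h"
    by (subst integrable_restrict_space) (simp_all only: eq, simp)
  have "(LINT x|lebesgue_on Lam. h x) = (LINT x|lebesgue_on {p..q}. h x)"
    by (subst (1 2) integral_restrict_space) (simp_all add: eq del: real_scaleR_def)
  then show "(LINT x|lebesgue_on Lam. h x) = integral {p..q} h"
    using int lebesgue_integral_eq_integral[of "{p..q}" h] by simp
qed

lemma L2_compact_support:
  fixes h :: "real \<Rightarrow> real"
  assumes "0 < p" "continuous_on {p..q} h" "\<And>x. x \<notin> {p..q} \<Longrightarrow> h x = 0"
  shows "h \<in> L2"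
proof (rule L2I)
  show "h \<in> borel_measurable (lebesgue_on Lam)"
    using integral_Lam_compact_support(1)[OF assms] by (rule borel_measurable_integrable)
  show "integrable (lebesgue_on Lam) (\<lambda>x. (h x)\<^sup>2)"
    using assms by (intro integral_Lam_compact_support(1)[of p q] continuous_on_power) auto
qed

lemma test_fun_has_derivative:
  assumes "\<phi> \<in> test_fun"
  shows "(\<phi> has_real_derivative deriv \<phi> x) (at x)"
proof -
  have "(deriv ^^ 0) \<phi> differentiable_on UNIV" using assms unfolding test_fun_def by blast
  then show ?thesis
    by (simp add: differentiable_on_def DERIV_deriv_iff_real_differentiable)
qed

lemma test_fun_continuous_deriv:
  assumes "\<phi> \<in> test_fun"
  shows "continuous_on A (deriv \<phi>)"
proof -
  have "(deriv ^^ 1) \<phi> differentiable_on UNIV" using assms unfolding test_fun_def by blast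
  then show ?thesis
    using differentiable_imp_continuous_on continuous_on_subset by fastforce
qed

lemma test_fun_continuous:
  assumes "\<phi> \<in> test_fun"
  shows "continuous_on A \<phi>"
  using test_fun_has_derivative[OF assms]
  by (meson DERIV_isCont continuous_at_imp_continuous_on)

lemma test_fun_support:
  assumes "\<phi> \<in> test_fun"
  obtains p q where "0 < p" "p \<le> q" "\<And>x. x \<notin> {p<..<q} \<Longrightarrow> \<phi> x = 0" "\<And>x. x \<notin> {p..q} \<Longrightarrow> deriv \<phi> x = 0"
proof -
  define K where "K = closure {x. \<phi> x \<noteq> 0}"
  have K: "compact K" "K \<subseteq> Lam" "\<And>x. x \<notin> K \<Longrightarrow> \<phi> x = 0"
    using assms closure_subset[of "{x. \<phi> x \<noteq> 0}"] by (auto simp: test_fun_def K_def)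
  have "\<exists>p q. 0 < p \<and> p \<le> q \<and> K \<subseteq> {p<..<q}"
  proof (cases "K = {}")
    case True
    then show ?thesis by (intro exI[of _ 1]) auto
  next
    case False
    obtain m where m: "m \<in> K" "\<And>x. x \<in> K \<Longrightarrow> m \<le> x" using compact_attains_inf[OF K(1) False] by blast
    obtain M where M: "M \<in> K" "\<And>x. x \<in> K \<Longrightarrow> x \<le> M" using compact_attains_sup[OF K(1) False] by blast
    have "0 < m" using m(1) K(2) by auto
    then show ?thesis
      using m M by (intro exI[of _ "m / 2"] exI[of _ "M + 1"]) fastforce
  qed
  then obtain p q where pq: "0 < p" "p \<le> q" "K \<subseteq> {p<..<q}" by blast
  have zero: "\<phi> x = 0" if "x \<notin> {p<..<q}" for x using K(3) pq(3) that by blast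
  have "deriv \<phi> x = 0" if "x \<notin> {p..q}" for x
  proof (rule DERIV_imp_deriv)
    show "(\<phi> has_real_derivative 0) (at x)"
      by (rule has_field_derivative_transform_within_open[of "\<lambda>_. 0" _ _ "- {p..q}"])
        (use that zero in auto)
  qed
  then show ?thesis using that[of p q] pq zero by blast
qed

lemma test_fun_L2: "\<phi> \<in> test_fun \<Longrightarrow> \<phi> \<in> L2" "\<phi> \<in> test_fun \<Longrightarrow> deriv \<phi> \<in> L2"
proof -
  assume \<phi>: "\<phi> \<in> test_fun"
  obtain p q where "0 < p" "\<And>x. x \<notin> {p<..<q} \<Longrightarrow> \<phi> x = 0" "\<And>x. x \<notin> {p..q} \<Longrightarrow> deriv \<phi> x = 0"
    using test_fun_support[OF \<phi>] by metis
  then show "\<phi> \<in> L2" "deriv \<phi> \<in> L2"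
    using test_fun_continuous[OF \<phi>] test_fun_continuous_deriv[OF \<phi>]
    by (auto intro!: L2_compact_support[of p q])
qed

text \<open>
  The product with a test function is continuously differentiable with compact support in
  \<open>\<Lambda>\<close>, so the integral of its derivative vanishes.
\<close>

lemma is_weak_deriv_classical:
  assumes v: "\<And>x. (v has_real_derivative v' x) (at x)" and v': "continuous_on UNIV v'"
  shows "is_weak_deriv v v'"
  unfolding is_weak_deriv_def
proof
  fix \<phi> assume \<phi>: "\<phi> \<in> test_fun"
  obtain p q where pq: "0 < p" "p \<le> q" "\<And>x. x \<notin> {p<..<q} \<Longrightarrow> \<phi> x = 0" "\<And>x. x \<notin> {p..q} \<Longrightarrow> deriv \<phi> x = 0"
    using test_fun_support[OF \<phi>] by metis
  have zero: "\<phi> x = 0" if "x \<notin> {p..q}" for x using pq(3)[of x] that by auto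
  have cv: "continuous_on A v" "continuous_on A v'" for A
    using v v' by (meson DERIV_isCont continuous_at_imp_continuous_on, meson continuous_on_subset subset_UNIV)
  note supp = integral_Lam_compact_support[OF pq(1), of q]
  have int: "integrable (lebesgue_on Lam) (\<lambda>x. v x * deriv \<phi> x)" "integrable (lebesgue_on Lam) (\<lambda>x. v' x * \<phi> x)"
    by (intro supp(1) continuous_intros cv test_fun_continuous[OF \<phi>] test_fun_continuous_deriv[OF \<phi>];
        simp add: zero pq(4))+
  have "L2_inner v (deriv \<phi>) + L2_inner v' \<phi> = (LINT x|lebesgue_on Lam. v x * deriv \<phi> x + v' x * \<phi> x)"
    using int by (simp add: L2_inner_def)
  also have "\<dots> = integral {p..q} (\<lambda>x. v x * deriv \<phi> x + v' x * \<phi> x)"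
    by (intro supp(2) continuous_intros cv test_fun_continuous[OF \<phi>] test_fun_continuous_deriv[OF \<phi>])
      (simp add: zero pq(4))
  also have "\<dots> = v q * \<phi> q - v p * \<phi> p"
  proof (rule integral_unique, rule fundamental_theorem_of_calculus[OF pq(2)])
    show "((\<lambda>x. v x * \<phi> x) has_vector_derivative v x * deriv \<phi> x + v' x * \<phi> x) (at x within {p..q})" for x
      using DERIV_mult[OF v[of x] test_fun_has_derivative[OF \<phi>, of x]]
      by (simp add: has_real_derivative_iff_has_vector_derivative[symmetric] has_field_derivative_at_within mult.commute add.commute)
  qed
  also have "\<dots> = 0" using pq(3)[of p] pq(3)[of q] by simp
  finally show "L2_inner v (deriv \<phi>) = - L2_inner v' \<phi>" by simp
qed

text \<open>
  The derivatives of the steps, scaled to the intervals \<open>[c, c + 1/(n+1)]\<close>, form an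
  approximate identity at \<open>c\<close>.
\<close>

lemma bump_mass_tendsto:
  assumes u: "continuous_on {0..} u" and c: "0 < c"
    and s': "s' \<in> flat_alg" "\<And>x. (s has_real_derivative s' x) (at x)" "\<And>x. 0 \<le> s' x"
      "\<And>x. x \<notin> {0..1} \<Longrightarrow> s' x = 0" "s 0 = 0" "s 1 = (1::real)"
  shows "(\<lambda>n. L2_inner u (\<lambda>x. (real n + 1) * s' ((real n + 1) * x - (real n + 1) * c))) \<longlonglongrightarrow> u c"
proof (rule LIMSEQ_I)
  fix e :: real assume e: "0 < e"
  have "continuous (at c) u"
    using continuous_on_interior[OF u, of c] c by simp
  then obtain d where d: "0 < d" "\<And>x. \<bar>x - c\<bar> < d \<Longrightarrow> \<bar>u x - u c\<bar> < e / 2"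
    using e unfolding continuous_at_eps_delta by (metis dist_real_def half_gt_zero)
  obtain n0 :: nat where n0: "1 / d < real n0" using reals_Archimedean2 by blast
  show "\<exists>no. \<forall>n\<ge>no. norm (L2_inner u (\<lambda>x. (real n + 1) * s' ((real n + 1) * x - (real n + 1) * c)) - u c) < e"
  proof (intro exI allI impI)
    fix n assume "n0 \<le> n"
    define N where "N = real n + 1"
    have "1 / d < N" "0 < N" using n0 \<open>n0 \<le> n\<close> by (simp_all add: N_def)
    then have N: "0 < N" "1 / N < d" using d(1) by (simp_all add: field_simps)
    define k where "k x = N * s' (N * x - N * c)" for x
    define q where "q = c + 1 / N"
    have cq: "c \<le> q" using N by (simp add: q_def)
    have k0: "k x = 0" if "x \<notin> {c..q}" for x
    proof -
      have "N * x - N * c \<notin> {0..1}"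
      proof -
        have "x < c \<or> q < x" using that by auto
        then have "N * x < N * c \<or> N * q < N * x" using N(1) by (auto intro: mult_strict_left_mono)
        moreover have "N * q = N * c + 1" using N(1) by (simp add: q_def distrib_left)
        ultimately show ?thesis by auto
      qed
      then show ?thesis using s'(4) by (simp add: k_def)
    qed
    have k_nonneg: "0 \<le> k x" for x using s'(3) N by (simp add: k_def)
    have ck: "continuous_on A k" for A
    proof -
      have "k \<in> flat_alg"
        unfolding k_def using flat_alg.mult[OF flat_alg.const flat_alg_affine[OF s'(1), of N "- (N * c)"]] by simp
      then show ?thesis
        using flat_alg_differentiable differentiable_imp_continuous_on continuous_on_subset by blast
    qed
    have cu: "continuous_on {c..q} u" using continuous_on_subset[OF u] c by auto
    have "(k has_integral s (N * q - N * c) - s (N * c - N * c)) {c..q}"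
    proof (rule fundamental_theorem_of_calculus[OF cq])
      fix x
      have "((\<lambda>x. s (N * x - N * c)) has_real_derivative s' (N * x - N * c) * N) (at x)"
        using DERIV_chain2[OF s'(2) DERIV_diff[OF DERIV_cmult_Id DERIV_const]] by simp
      then show "((\<lambda>x. s (N * x - N * c)) has_vector_derivative k x) (at x within {c..q})"
        by (simp add: has_real_derivative_iff_has_vector_derivative[symmetric] has_field_derivative_at_within k_def mult.commute)
    qed
    moreover have "N * q - N * c = 1" using N(1) by (simp add: q_def field_simps)
    ultimately have "integral {c..q} k = 1" using s'(5,6) by (simp add: integral_unique)
    then have mass: "(LINT x|lebesgue_on Lam. k x) = 1"
      using integral_Lam_compact_support(2)[OF c ck k0] by simp
    have ik: "integrable (lebesgue_on Lam) k"
      by (rule integral_Lam_compact_support(1)[OF c ck k0])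
    have iuk: "integrable (lebesgue_on Lam) (\<lambda>x. u x * k x)"
      by (rule integral_Lam_compact_support(1)[OF c]) (auto intro!: continuous_intros cu ck simp: k0)
    have "L2_inner u k - u c = (LINT x|lebesgue_on Lam. (u x - u c) * k x)"
      using iuk ik mass by (simp add: L2_inner_def left_diff_distrib)
    also have "\<bar>\<dots>\<bar> \<le> (LINT x|lebesgue_on Lam. \<bar>(u x - u c) * k x\<bar>)"
      by (rule integral_abs_bound)
    also have "\<dots> \<le> (LINT x|lebesgue_on Lam. e / 2 * k x)"
    proof (rule integral_mono)
      show "integrable (lebesgue_on Lam) (\<lambda>x. \<bar>(u x - u c) * k x\<bar>)"
        using iuk ik by (intro integrable_abs) (simp add: left_diff_distrib)
      show "integrable (lebesgue_on Lam) (\<lambda>x. e / 2 * k x)" using ik by simp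
      fix x
      show "\<bar>(u x - u c) * k x\<bar> \<le> e / 2 * k x"
      proof (cases "x \<in> {c..q}")
        case True
        then have "\<bar>x - c\<bar> < d" using N(2) by (auto simp: q_def)
        then have "\<bar>u x - u c\<bar> \<le> e / 2" using d(2)[of x] by simp
        then have "\<bar>u x - u c\<bar> * k x \<le> e / 2 * k x" using k_nonneg by (rule mult_right_mono)
        then show ?thesis using k_nonneg[of x] by (simp add: abs_mult)
      qed (simp add: k0)
    qed
    also have "\<dots> = e / 2" using mass by simp
    finally show "norm (L2_inner u (\<lambda>x. (real n + 1) * s' ((real n + 1) * x - (real n + 1) * c)) - u c) < e"
      using e unfolding k_def N_def by simp
  qed
qed

text \<open>
  The fundamental theorem of calculus for weak derivatives. The test functions \<open>\<phi> n\<close> rise from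
  \<open>0\<close> to \<open>1\<close> just to the right of \<open>a\<close> and fall back just to the right of \<open>b\<close>. Hence \<open>(g, \<phi> n)\<close>
  tends to the integral of \<open>g\<close> over \<open>(a,b]\<close>, while \<open>-(u, deriv (\<phi> n))\<close> tends to \<open>u b - u a\<close>.
\<close>

lemma weak_deriv_increment:
  assumes u: "continuous_on {0..} u" "u \<in> L2" and g: "g \<in> L2" and weak: "is_weak_deriv u g"
    and ab: "0 < a" "a < b"
  shows "L2_inner g (indicator {a<..b}) = u b - u a"
proof -
  obtain s' s :: "real \<Rightarrow> real" where s': "s' \<in> flat_alg" "\<And>x. (s has_real_derivative s' x) (at x)"
    "\<And>x. 0 \<le> s' x" "\<And>x. x \<notin> {0..1} \<Longrightarrow> s' x = 0"
    "\<And>x. x \<le> 0 \<Longrightarrow> s x = 0" "\<And>x. 1 \<le> x \<Longrightarrow> s x = 1" "\<And>x. 0 \<le> s x" "\<And>x. s x \<le> 1"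
    by (rule smooth_step_exists, rule that)
  define k where "k c n x = (real n + 1) * s' ((real n + 1) * x - (real n + 1) * c)" for c n x
  define \<phi> where "\<phi> n x = s ((real n + 1) * x - (real n + 1) * a) - s ((real n + 1) * x - (real n + 1) * b)" for n x
  have k_alg: "k c n \<in> flat_alg" for c n
    unfolding k_def using flat_alg.mult[OF flat_alg.const flat_alg_affine[OF s'(1), of "real n + 1" "- ((real n + 1) * c)"]] by simp
  have \<phi>': "(\<phi> n has_real_derivative k a n x + (-1) * k b n x) (at x)" for n x
  proof -
    have "((\<lambda>x. s ((real n + 1) * x - (real n + 1) * c)) has_real_derivative k c n x) (at x)" for c
      using DERIV_chain2[OF s'(2) DERIV_diff[OF DERIV_cmult_Id DERIV_const], of "real n + 1" "(real n + 1) * c" x UNIV]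
      by (simp add: k_def mult.commute)
    from DERIV_diff[OF this[of a] this[of b]] show ?thesis
      unfolding \<phi>_def by simp
  qed
  have deriv_\<phi>: "deriv (\<phi> n) = (\<lambda>x. k a n x + (-1) * k b n x)" for n
    using DERIV_imp_deriv[OF \<phi>'] by blast
  have deriv_alg: "deriv (\<phi> n) \<in> flat_alg" for n
    unfolding deriv_\<phi> by (intro flat_alg.intros k_alg)
  have \<phi>0: "\<phi> n x = 0" if "x \<notin> {a..b+1}" for n x
  proof -
    have "x \<le> a \<or> b + 1 \<le> x" using that by auto
    then show ?thesis
    proof
      assume "x \<le> a"
      then have "(real n + 1) * x \<le> (real n + 1) * a" "(real n + 1) * x \<le> (real n + 1) * b"
        using ab by (auto intro: mult_left_mono)
      then show ?thesis by (simp add: \<phi>_def s'(5))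
    next
      assume "b + 1 \<le> x"
      then have "(real n + 1) * (b + 1) \<le> (real n + 1) * x" "(real n + 1) * (a + 1) \<le> (real n + 1) * x"
        using ab by (auto intro: mult_left_mono)
      then show ?thesis by (simp add: \<phi>_def s'(6) algebra_simps)
    qed
  qed
  have test: "\<phi> n \<in> test_fun" for n
  proof -
    have "(deriv ^^ m) (\<phi> n) differentiable_on UNIV" for m
    proof (cases m)
      case 0
      then show ?thesis
        using \<phi>'[of n] by (auto simp: differentiable_on_def differentiable_def has_field_derivative_def)
    next
      case (Suc j)
      then show ?thesis
        using flat_alg_differentiable[OF flat_alg_iterated_deriv[OF deriv_alg[of n], of j]]
        by (simp only: funpow_Suc_right o_apply)
    qed
    moreover have supp: "closure {x. \<phi> n x \<noteq> 0} \<subseteq> {a..b+1}"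
    proof (rule closure_minimal)
      show "{x. \<phi> n x \<noteq> 0} \<subseteq> {a..b+1}" using \<phi>0[of _ n] by blast
    qed simp
    moreover have "compact (closure {x. \<phi> n x \<noteq> 0})"
      using bounded_subset[OF bounded_closed_interval supp] by (simp add: compact_eq_bounded_closed)
    moreover have "{a..b+1} \<subseteq> Lam" using ab by auto
    ultimately show ?thesis
      unfolding test_fun_def by blast
  qed
  have kL2: "k c n \<in> L2" if "0 < c" for c n
  proof (rule L2_compact_support[of c "c + 1"])
    show "continuous_on {c..c+1} (k c n)"
      using flat_alg_differentiable[OF k_alg] differentiable_imp_continuous_on continuous_on_subset by blast
    fix x assume "x \<notin> {c..c+1}"
    then have "x < c \<or> c + 1 < x" by auto
    then have "(real n + 1) * x < (real n + 1) * c \<or> (real n + 1) * (c + 1) < (real n + 1) * x"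
      by (auto intro: mult_strict_left_mono)
    then have "(real n + 1) * x - (real n + 1) * c \<notin> {0..1}"
      by (auto simp: algebra_simps)
    then show "k c n x = 0" unfolding k_def using s'(4) by simp
  qed (use that in auto)
  have u_loc: "L2_inner u (\<lambda>x. k a n x + (-1) * k b n x) = L2_inner u (k a n) - L2_inner u (k b n)" for n
    using L2_mult_integrable[OF u(2) kL2] ab by (simp add: L2_inner_def right_diff_distrib)
  have "(\<lambda>n. L2_inner u (k a n) - L2_inner u (k b n)) \<longlonglongrightarrow> u a - u b"
    unfolding k_def using ab s'(5)[of 0] s'(6)[of 1]
    by (intro tendsto_diff bump_mass_tendsto[where s = s] u(1) s'(1-4)) simp_all
  moreover have "L2_inner u (k a n) - L2_inner u (k b n) = - L2_inner g (\<phi> n)" for n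
    using weak test[of n] u_loc[of n] unfolding is_weak_deriv_def deriv_\<phi>[of n, symmetric] by simp
  ultimately have lim1: "(\<lambda>n. - L2_inner g (\<phi> n)) \<longlonglongrightarrow> u a - u b" by simp
  have lim2: "(\<lambda>n. L2_inner g (\<phi> n)) \<longlonglongrightarrow> L2_inner g (indicator {a<..b})"
    unfolding L2_inner_def
  proof (rule integral_dominated_convergence[where w = "\<lambda>x. \<bar>g x * indicator {a<..b+2} x\<bar>"])
    show "(\<lambda>x. g x * indicator {a<..b} x) \<in> borel_measurable (lebesgue_on Lam)"
      using g by (intro borel_measurable_times L2_measurable interval_indicator_L2)
    show "(\<lambda>x. g x * \<phi> n x) \<in> borel_measurable (lebesgue_on Lam)" for n
      using g test_fun_L2(1)[OF test] by (intro borel_measurable_times L2_measurable)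
    show "integrable (lebesgue_on Lam) (\<lambda>x. \<bar>g x * indicator {a<..b+2} x\<bar>)"
      using g by (intro integrable_abs L2_mult_integrable interval_indicator_L2)
    show "AE x in lebesgue_on Lam. norm (g x * \<phi> n x) \<le> \<bar>g x * indicator {a<..b+2} x\<bar>" for n
    proof (rule AE_I2)
      fix x
      have "\<bar>\<phi> n x\<bar> \<le> 1" 
        using s'(7,8)[of "(real n + 1) * x - (real n + 1) * a"] s'(7,8)[of "(real n + 1) * x - (real n + 1) * b"]
        unfolding \<phi>_def by linarith
      moreover have "\<phi> n x = 0" if "x \<le> a"
      proof (cases "x = a")
        case True
        have "(real n + 1) * a \<le> (real n + 1) * b" using ab by (intro mult_left_mono) auto
        then show ?thesis using True s'(5) by (simp add: \<phi>_def)
      qed (use that \<phi>0 in auto)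
      ultimately have "\<bar>\<phi> n x\<bar> \<le> indicator {a<..b+2} x"
        using \<phi>0[of x n] by (auto simp: indicator_def)
      then show "norm (g x * \<phi> n x) \<le> \<bar>g x * indicator {a<..b+2} x\<bar>"
        by (simp add: abs_mult mult_left_mono)
    qed
    show "AE x in lebesgue_on Lam. (\<lambda>n. g x * \<phi> n x) \<longlonglongrightarrow> g x * indicator {a<..b} x"
    proof (rule AE_I2, intro tendsto_mult_left)
      fix x
      have step: "(\<lambda>n. s ((real n + 1) * x - (real n + 1) * c)) \<longlonglongrightarrow> indicator {c<..} x" for c
      proof (rule tendsto_eventually)
        show "\<forall>\<^sub>F n in sequentially. s ((real n + 1) * x - (real n + 1) * c) = indicator {c<..} x"
        proof (cases "c < x")
          case True
          have "\<forall>\<^sub>F n in sequentially. 1 \<le> (real n + 1) * (x - c)"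
            using True by real_asymp
          then show ?thesis
            by eventually_elim (use True s'(6) in \<open>auto simp: right_diff_distrib\<close>)
        next
          case False
          then have "(real n + 1) * x \<le> (real n + 1) * c" for n by (intro mult_left_mono) auto
          then show ?thesis using False s'(5) by simp
        qed
      qed
      have "indicator {a<..} x - indicator {b<..} x = (indicator {a<..b} x :: real)"
        using ab by (auto simp: indicator_def)
      then show "(\<lambda>n. \<phi> n x) \<longlonglongrightarrow> indicator {a<..b} x"
        unfolding \<phi>_def using tendsto_diff[OF step[of a] step[of b]] by simp
    qed
  qed
  have "- L2_inner g (indicator {a<..b}) = u a - u b"
    using LIMSEQ_unique[OF tendsto_minus[OF lim2] lim1] .
  then show ?thesis by simp
qed

text \<open>
  Dominated convergence, in the form that matches the limit condition of
  \<open>L2_closed_subspace_eq\<close>.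
\<close>

lemma L2_inner_tendsto:
  assumes "d \<in> L2" "\<And>n. s n \<in> L2" "f \<in> L2" "g \<in> L2"
    and "AE x in lebesgue_on Lam. (\<lambda>n. s n x) \<longlonglongrightarrow> f x"
    and "\<And>n. AE x in lebesgue_on Lam. \<bar>s n x\<bar> \<le> g x"
  shows "(\<lambda>n. L2_inner d (s n)) \<longlonglongrightarrow> L2_inner d f"
  unfolding L2_inner_def
proof (rule integral_dominated_convergence[where w = "\<lambda>x. \<bar>d x * g x\<bar>"])
  show "(\<lambda>x. d x * f x) \<in> borel_measurable (lebesgue_on Lam)"
    using assms(1,3) by (intro borel_measurable_times L2_measurable)
  show "(\<lambda>x. d x * s n x) \<in> borel_measurable (lebesgue_on Lam)" for n
    using assms(1,2) by (intro borel_measurable_times L2_measurable)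
  show "integrable (lebesgue_on Lam) (\<lambda>x. \<bar>d x * g x\<bar>)"
    using assms(1,4) by (intro integrable_abs L2_mult_integrable)
  show "AE x in lebesgue_on Lam. norm (d x * s n x) \<le> \<bar>d x * g x\<bar>" for n
    using assms(6)[of n]
  proof eventually_elim
    case (elim x)
    then have "\<bar>s n x\<bar> \<le> \<bar>g x\<bar>" by linarith
    then show ?case by (simp add: abs_mult mult_left_mono)
  qed
  show "AE x in lebesgue_on Lam. (\<lambda>n. d x * s n x) \<longlonglongrightarrow> d x * f x"
    using assms(5) by eventually_elim (rule tendsto_mult_left)
qed

lemma L2_orthogonal_to_intervals:
  assumes d: "d \<in> L2" and "\<And>a b. \<lbrakk>0 < a; a < b\<rbrakk> \<Longrightarrow> L2_inner d (indicator {a<..b}) = 0"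
  shows "AE x in lebesgue_on Lam. d x = 0"
proof -
  have "{v \<in> L2. L2_inner d v = 0} = L2"
  proof (rule L2_closed_subspace_eq)
    fix u v assume "u \<in> {v \<in> L2. L2_inner d v = 0}" "v \<in> {v \<in> L2. L2_inner d v = 0}"
    then show "(\<lambda>x. u x + v x) \<in> {v \<in> L2. L2_inner d v = 0}"
      using d L2.add_left[of u v d] by (simp add: L2_add L2.commute[of d])
  next
    fix c u assume "u \<in> {v \<in> L2. L2_inner d v = 0}"
    then show "(\<lambda>x. c * u x) \<in> {v \<in> L2. L2_inner d v = 0}"
      using d L2.scale_left[of u d c] by (simp add: L2_scale L2.commute[of d])
  next
    fix s :: "nat \<Rightarrow> real \<Rightarrow> real" and g f :: "real \<Rightarrow> real"
    assume s: "\<And>n. s n \<in> {v \<in> L2. L2_inner d v = 0}" and fg: "f \<in> L2" "g \<in> L2"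
      and lim: "AE x in lebesgue_on Lam. (\<lambda>n. s n x) \<longlonglongrightarrow> f x"
        "\<And>n. AE x in lebesgue_on Lam. \<bar>s n x\<bar> \<le> g x"
    have "(\<lambda>n. L2_inner d (s n)) \<longlonglongrightarrow> L2_inner d f"
      by (rule L2_inner_tendsto[OF d _ fg lim]) (use s in auto)
    moreover have "(\<lambda>n. L2_inner d (s n)) = (\<lambda>n. 0)" using s by auto
    ultimately have "(\<lambda>n::nat. 0) \<longlonglongrightarrow> L2_inner d f" by simp
    then have "L2_inner d f = 0" using LIMSEQ_unique tendsto_const by blast
    then show "f \<in> {v \<in> L2. L2_inner d v = 0}" using fg by simp
  qed (use assms interval_indicator_L2 in auto)
  then show ?thesis using d by (intro L2_inner_self_eq_0) auto
qed

lemma is_weak_deriv_add: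
  assumes "u \<in> L2" "v \<in> L2" "g \<in> L2" "h \<in> L2" "is_weak_deriv u g" "is_weak_deriv v h"
  shows "is_weak_deriv (\<lambda>x. u x + v x) (\<lambda>x. g x + h x)"
  using assms by (auto simp: is_weak_deriv_def L2.add_left test_fun_L2)

lemma is_weak_deriv_scale:
  assumes "u \<in> L2" "g \<in> L2" "is_weak_deriv u g"
  shows "is_weak_deriv (\<lambda>x. c * u x) (\<lambda>x. c * g x)"
  using assms by (auto simp: is_weak_deriv_def L2.scale_left test_fun_L2)

text \<open>
  The difference is a weak derivative of the zero function, so its integrals over all
  intervals vanish.
\<close>

lemma weak_deriv_unique:
  assumes "g \<in> L2" "h \<in> L2" "is_weak_deriv u g" "is_weak_deriv u h"
  shows "AE x in lebesgue_on Lam. g x = h x"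
proof -
  have d: "(\<lambda>x. g x - h x) \<in> L2" using assms by (intro L2.diff_mem)
  have "is_weak_deriv (\<lambda>x. 0) (\<lambda>x. g x - h x)"
    unfolding is_weak_deriv_def
  proof
    fix \<phi> assume \<phi>: "\<phi> \<in> test_fun"
    have "L2_inner g \<phi> = L2_inner h \<phi>"
      using assms(3,4) \<phi> unfolding is_weak_deriv_def by (metis neg_equal_iff_equal)
    then show "L2_inner (\<lambda>x. 0) (deriv \<phi>) = - L2_inner (\<lambda>x. g x - h x) \<phi>"
      using L2.diff_left[OF assms(1,2) test_fun_L2(1)[OF \<phi>]] L2.zero_left[OF test_fun_L2(2)[OF \<phi>]] by simp
  qed
  from weak_deriv_increment[OF _ L2_zero d this]
  have "AE x in lebesgue_on Lam. g x - h x = 0"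
    by (intro L2_orthogonal_to_intervals d) auto
  then show ?thesis by eventually_elim simp
qed

section \<open>Traces and integration by parts in the Sobolev space\<close>

lemma H1_continuous: "u \<in> H1 \<Longrightarrow> continuous_on {0..} u"
  and H1_L2: "u \<in> H1 \<Longrightarrow> u \<in> L2"
  by (simp_all add: H1_def)

lemma H1_wderiv:
  assumes "u \<in> H1"
  shows "wderiv u \<in> L2" "is_weak_deriv u (wderiv u)"
proof -
  have "\<exists>g. g \<in> L2 \<and> is_weak_deriv u g" using assms by (auto simp: H1_def)
  then have "wderiv u \<in> L2 \<and> is_weak_deriv u (wderiv u)"
    unfolding wderiv_def by (rule someI_ex)
  then show "wderiv u \<in> L2" "is_weak_deriv u (wderiv u)" by auto
qed

lemma H1I: "\<lbrakk>continuous_on {0..} u; u \<in> L2; g \<in> L2; is_weak_deriv u g\<rbrakk> \<Longrightarrow> u \<in> H1"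
  by (auto simp: H1_def)

lemma wderiv_AE_eq:
  assumes "u \<in> H1" "g \<in> L2" "is_weak_deriv u g"
  shows "AE x in lebesgue_on Lam. wderiv u x = g x"
  using assms H1_wderiv weak_deriv_unique by blast

lemma L2_inner_wderiv:
  assumes "u \<in> H1" "g \<in> L2" "is_weak_deriv u g" "v \<in> L2"
  shows "L2_inner (wderiv u) v = L2_inner g v"
  using assms by (intro L2_inner_cong_AE wderiv_AE_eq H1_wderiv)

lemma H1_add:
  assumes "u \<in> H1" "v \<in> H1"
  shows "(\<lambda>x. u x + v x) \<in> H1" "is_weak_deriv (\<lambda>x. u x + v x) (\<lambda>x. wderiv u x + wderiv v x)"
proof -
  show "is_weak_deriv (\<lambda>x. u x + v x) (\<lambda>x. wderiv u x + wderiv v x)"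
    using assms by (intro is_weak_deriv_add H1_L2 H1_wderiv)
  then show "(\<lambda>x. u x + v x) \<in> H1"
    using assms by (rule_tac H1I) (auto intro: H1_continuous continuous_on_add L2_add H1_L2 H1_wderiv)
qed

lemma H1_scale:
  assumes "u \<in> H1"
  shows "(\<lambda>x. c * u x) \<in> H1" "is_weak_deriv (\<lambda>x. c * u x) (\<lambda>x. c * wderiv u x)"
proof -
  show "is_weak_deriv (\<lambda>x. c * u x) (\<lambda>x. c * wderiv u x)"
    using assms by (intro is_weak_deriv_scale H1_L2 H1_wderiv)
  then show "(\<lambda>x. c * u x) \<in> H1"
    using assms by (rule_tac H1I) (auto intro: H1_continuous continuous_on_mult_left L2_scale H1_L2 H1_wderiv)
qed

lemma H1_zero: "(\<lambda>x. 0) \<in> H1"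
  by (rule H1I[OF _ L2_zero L2_zero]) (auto simp: is_weak_deriv_def L2.zero_left test_fun_L2)

interpretation Dirichlet: semi_inner H1 "\<lambda>u v. L2_inner (wderiv u) (wderiv v)"
proof
  show "L2_inner (wderiv (\<lambda>x. u x + v x)) (wderiv w) = L2_inner (wderiv u) (wderiv w) + L2_inner (wderiv v) (wderiv w)"
    if "u \<in> H1" "v \<in> H1" "w \<in> H1" for u v w
    using that by (subst L2_inner_wderiv[OF H1_add(1) _ H1_add(2)]) (auto intro: L2_add H1_wderiv L2.add_left)
  show "L2_inner (wderiv (\<lambda>x. c * u x)) (wderiv w) = c * L2_inner (wderiv u) (wderiv w)"
    if "u \<in> H1" "w \<in> H1" for u w c
    using that by (subst L2_inner_wderiv[OF H1_scale(1) _ H1_scale(2)]) (auto intro: L2_scale H1_wderiv L2.scale_left)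
qed (auto intro: H1_zero H1_add H1_scale L2.commute L2.nonneg H1_wderiv)

lemma robin_semi_inner:
  assumes "\<gamma> \<ge> 0" "\<mu> \<ge> 0"
  shows "semi_inner H1 (robin_form \<gamma> \<mu>)"
proof
  show "robin_form \<gamma> \<mu> u v = robin_form \<gamma> \<mu> v u" for u v
    by (simp add: robin_form_def L2.commute[of u v] Dirichlet.commute[of u v])
  show "robin_form \<gamma> \<mu> (\<lambda>x. u x + v x) w = robin_form \<gamma> \<mu> u w + robin_form \<gamma> \<mu> v w"
    if "u \<in> H1" "v \<in> H1" "w \<in> H1" for u v w
    using Dirichlet.add_left[OF that] L2.add_left[OF that[THEN H1_L2]]
    by (simp add: robin_form_def distrib_left distrib_right)
  show "robin_form \<gamma> \<mu> (\<lambda>x. c * u x) w = c * robin_form \<gamma> \<mu> u w"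
    if "u \<in> H1" "w \<in> H1" for u w c
    using Dirichlet.scale_left[OF that] L2.scale_left[OF that[THEN H1_L2]]
    by (simp add: robin_form_def distrib_left)
  show "0 \<le> robin_form \<gamma> \<mu> u u" if "u \<in> H1" for u
    using assms L2.nonneg[OF H1_L2[OF that]] Dirichlet.nonneg[OF that]
    by (simp add: robin_form_def mult.assoc)
qed (auto intro: H1_zero H1_add H1_scale)

lemma H1_increment:
  assumes u: "u \<in> H1" and ab: "0 \<le> a" "a \<le> b"
  shows "L2_inner (wderiv u) (indicator {a<..b}) = u b - u a"
proof -
  note inc = weak_deriv_increment[OF H1_continuous[OF u] H1_L2[OF u] H1_wderiv[OF u]]
  consider "a = b" | "0 < a" "a < b" | "a = 0" "0 < b" using ab by linarith
  then show ?thesis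
  proof cases
    case 1
    then show ?thesis by (simp add: L2_inner_def)
  next
    case 2
    then show ?thesis using inc by simp
  next
    case 3
    define c where "c n = b / (real n + 2)" for n
    have c: "0 < c n" "c n < b" for n
      using 3 mult_nonneg_nonneg[of b "real n"] by (auto simp: c_def field_simps intro: less_le_trans[of 0 b])
    have c0: "c \<longlonglongrightarrow> 0" unfolding c_def by real_asymp
    have "(\<lambda>n. L2_inner (wderiv u) (indicator {c n<..b})) \<longlonglongrightarrow> L2_inner (wderiv u) (indicator {0<..b})"
    proof (rule L2_inner_tendsto[where g = "indicator {0<..b}"])
      show "AE x in lebesgue_on Lam. (\<lambda>n. indicator {c n<..b} x) \<longlonglongrightarrow> (indicator {0<..b} x :: real)"
      proof (rule AE_I2)
        fix x :: real assume "x \<in> space (lebesgue_on Lam)"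
        then have "0 < x" by simp
        then have "\<forall>\<^sub>F n in sequentially. c n < x" by (rule order_tendstoD[OF c0])
        then have "\<forall>\<^sub>F n in sequentially. indicator {c n<..b} x = (indicator {0<..b} x :: real)"
          by eventually_elim (use \<open>0 < x\<close> in \<open>auto simp: indicator_def\<close>)
        then show "(\<lambda>n. indicator {c n<..b} x) \<longlonglongrightarrow> (indicator {0<..b} x :: real)"
          by (rule tendsto_eventually)
      qed
      show "AE x in lebesgue_on Lam. \<bar>indicator {c n<..b} x\<bar> \<le> (indicator {0<..b} x :: real)" for n
        by (intro AE_I2) (auto simp: indicator_def)
    qed (intro H1_wderiv u interval_indicator_L2)+
    moreover have "(\<lambda>n. L2_inner (wderiv u) (indicator {c n<..b})) = (\<lambda>n. u b - u (c n))"
      using inc c by simp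
    moreover have "(\<lambda>n. u b - u (c n)) \<longlonglongrightarrow> u b - u 0"
    proof (intro tendsto_intros)
      show "(\<lambda>n. u (c n)) \<longlonglongrightarrow> u 0"
        using H1_continuous[OF u] c0 c(1)
        unfolding continuous_on_sequentially o_def by (metis atLeast_iff less_imp_le order_refl)
    qed
    ultimately show ?thesis using 3 LIMSEQ_unique by metis
  qed
qed

lemma L2_inner_interval:
  assumes "0 \<le> b" "x \<le> b"
  shows "L2_inner g (indicator {0<..x}) = (LINT y|lebesgue_on {0<..b}. g y * indicator {..x} y)"
proof -
  have "(\<lambda>y. indicator Lam y *\<^sub>R (g y * indicator {0<..x} y)) =
      (\<lambda>y. indicator {0<..b} y *\<^sub>R (g y * indicator {..x} y :: real))"
    using assms by (auto simp: indicator_def)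
  then show ?thesis
    unfolding L2_inner_def by (subst (1 2) integral_restrict_space) (simp_all del: real_scaleR_def)
qed

text \<open>
  Integration by parts for primitives that are only absolutely continuous, by Fubini: the two
  integrals are those of \<open>g1 x * g2 y\<close> over the triangles \<open>y \<le> x\<close> and \<open>x < y\<close>, which together fill
  the square. The diagonal is a null set, so it may be assigned to either triangle.
\<close>

lemma product_of_primitives:
  assumes g: "g1 \<in> L2" "g2 \<in> L2" and b: "0 \<le> b"
  defines "N \<equiv> lebesgue_on {0<..b}"
    and "G1 \<equiv> \<lambda>x. L2_inner g1 (indicator {0<..x})" and "G2 \<equiv> \<lambda>x. L2_inner g2 (indicator {0<..x})"
  shows "(LINT x|N. g1 x * G2 x) + (LINT x|N. g2 x * G1 x) = G1 b * G2 b"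
proof -
  interpret N: finite_measure N
    unfolding N_def by (intro finite_measure_lebesgue_on) (auto intro: bounded_set_imp_lmeasurable)
  interpret NN: pair_sigma_finite N N ..
  have int: "integrable N g" if "g \<in> L2" for g
  proof -
    have "(\<lambda>x. indicator Lam x *\<^sub>R (g x * indicator {0<..b} x)) = (\<lambda>x. indicator {0<..b} x *\<^sub>R g x)"
      by (auto simp: indicator_def)
    moreover have "integrable (lebesgue_on Lam) (\<lambda>x. g x * indicator {0<..b} x)"
      using that by (intro L2_mult_integrable interval_indicator_L2)
    ultimately show ?thesis
      unfolding N_def by (simp add: integrable_restrict_space del: real_scaleR_def)
  qed
  note [measurable] = borel_measurable_integrable[OF int[OF g(1)]] borel_measurable_integrable[OF int[OF g(2)]]
  have id: "(\<lambda>x. x) \<in> borel_measurable N"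
    unfolding N_def by (intro measurable_restrict_space1 measurable_completion) simp
  note fst_id [measurable] = measurable_compose[OF measurable_fst id]
    and snd_id [measurable] = measurable_compose[OF measurable_snd id]
  have prod: "integrable (N \<Otimes>\<^sub>M N) (\<lambda>(x, y). g1 x * g2 y)"
  proof (rule NN.Fubini_integrable)
    show "integrable N (\<lambda>x. LINT y|N. norm (case (x, y) of (x, y) \<Rightarrow> g1 x * g2 y))"
      using int[OF g(1)] by (simp add: abs_mult)
    show "AE x in N. integrable N (\<lambda>y. case (x, y) of (x, y) \<Rightarrow> g1 x * g2 y)"
      using int[OF g(2)] by simp
  qed measurable
  define F where "F = (\<lambda>x y. g1 x * g2 y * indicator {..x} y)"
  define F' where "F' = (\<lambda>x y. g1 x * g2 y * indicator {..<y} x)"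
  have F_int: "integrable (N \<Otimes>\<^sub>M N) (case_prod F)" "integrable (N \<Otimes>\<^sub>M N) (case_prod F')"
  proof -
    have ind: "(\<lambda>z. indicator {..fst z} (snd z) :: real) \<in> borel_measurable (N \<Otimes>\<^sub>M N)"
      "(\<lambda>z. indicator {..<snd z} (fst z) :: real) \<in> borel_measurable (N \<Otimes>\<^sub>M N)"
      unfolding indicator_def by simp_all
    have "case_prod F = (\<lambda>z. (case z of (x, y) \<Rightarrow> g1 x * g2 y) * indicator {..fst z} (snd z))"
      "case_prod F' = (\<lambda>z. (case z of (x, y) \<Rightarrow> g1 x * g2 y) * indicator {..<snd z} (fst z))"
      by (auto simp: F_def F'_def)
    then have "case_prod F \<in> borel_measurable (N \<Otimes>\<^sub>M N)" "case_prod F' \<in> borel_measurable (N \<Otimes>\<^sub>M N)"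
      using borel_measurable_integrable[OF prod] ind by (simp_all only: borel_measurable_times)
    then show "integrable (N \<Otimes>\<^sub>M N) (case_prod F)" "integrable (N \<Otimes>\<^sub>M N) (case_prod F')"
      using prod by (auto intro!: Bochner_Integration.integrable_bound[OF prod] AE_I2
          simp: F_def F'_def indicator_def abs_mult)
  qed
  have G: "L2_inner g (indicator {0<..x}) = (LINT y|N. g y * indicator {..x} y)" if "x \<in> space N" for g x
    using that b unfolding N_def by (intro L2_inner_interval) auto
  have "(LINT x|N. g1 x * G2 x) = (LINT x|N. LINT y|N. F x y)"
    unfolding G2_def F_def
    by (intro Bochner_Integration.integral_cong refl) (simp add: G mult.assoc)
  also have "\<dots> = integral\<^sup>L (N \<Otimes>\<^sub>M N) (case_prod F)"
    using NN.integral_fst[OF F_int(1)] by simp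
  finally have 1: "(LINT x|N. g1 x * G2 x) = integral\<^sup>L (N \<Otimes>\<^sub>M N) (case_prod F)" .
  have strict: "(LINT x|N. g1 x * indicator {..y} x) = (LINT x|N. g1 x * indicator {..<y} x)" for y
  proof (rule integral_cong_AE)
    have "AE x in lebesgue. x \<noteq> y"
      by (rule AE_I'[of "{y}"]) (auto simp: negligible_iff_null_sets[symmetric])
    then have "AE x in N. x \<noteq> y"
      unfolding N_def by (subst AE_restrict_space_iff) auto
    then show "AE x in N. g1 x * indicator {..y} x = g1 x * indicator {..<y} x"
      by eventually_elim (auto simp: indicator_def)
    show "(\<lambda>x. g1 x * indicator {..y} x) \<in> borel_measurable N"
      "(\<lambda>x. g1 x * indicator {..<y} x) \<in> borel_measurable N"
      using id unfolding indicator_def by simp_all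
  qed
  have "(LINT y|N. g2 y * G1 y) = (LINT y|N. LINT x|N. F' x y)"
  proof (intro Bochner_Integration.integral_cong refl)
    fix y assume "y \<in> space N"
    then have "g2 y * G1 y = g2 y * (LINT x|N. g1 x * indicator {..<y} x)"
      by (simp add: G1_def G strict)
    also have "\<dots> = (LINT x|N. g2 y * (g1 x * indicator {..<y} x))"
      by simp
    finally show "g2 y * G1 y = (LINT x|N. F' x y)"
      by (simp add: F'_def mult_ac)
  qed
  also have "\<dots> = integral\<^sup>L (N \<Otimes>\<^sub>M N) (case_prod F')"
    using NN.integral_snd[OF F_int(2)] .
  finally have 2: "(LINT y|N. g2 y * G1 y) = integral\<^sup>L (N \<Otimes>\<^sub>M N) (case_prod F')" .
  have "integral\<^sup>L (N \<Otimes>\<^sub>M N) (case_prod F) + integral\<^sup>L (N \<Otimes>\<^sub>M N) (case_prod F')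
      = integral\<^sup>L (N \<Otimes>\<^sub>M N) (\<lambda>z. case_prod F z + case_prod F' z)"
    using F_int by (rule Bochner_Integration.integral_add[symmetric])
  also have "(\<lambda>z. case_prod F z + case_prod F' z) = (\<lambda>(x, y). g1 x * g2 y)"
    by (auto simp: F_def F'_def indicator_def)
  also have "integral\<^sup>L (N \<Otimes>\<^sub>M N) \<dots> = (LINT x|N. LINT y|N. g1 x * g2 y)"
    using NN.integral_fst[OF prod] by simp
  also have "\<dots> = integral\<^sup>L N g1 * integral\<^sup>L N g2" by simp
  also have "\<dots> = G1 b * G2 b"
  proof -
    have "integral\<^sup>L N g = L2_inner g (indicator {0<..b})" for g
      unfolding L2_inner_interval[OF b order_refl] N_def
      by (intro Bochner_Integration.integral_cong) (auto simp: indicator_def)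
    then show ?thesis by (simp add: G1_def G2_def)
  qed
  finally show ?thesis using 1 2 by simp
qed

lemma tendsto_L2_inner_truncated:
  assumes "u \<in> L2" "v \<in> L2"
  shows "((\<lambda>b. LINT x|lebesgue_on {0<..b}. u x * v x) \<longlongrightarrow> L2_inner u v) at_top"
proof -
  have "(LINT x|lebesgue_on {0<..b}. u x * v x) = (LINT x|lebesgue_on Lam. u x * v x * indicator {0<..b} x)" for b
  proof -
    have "(\<lambda>x. indicator {0<..b} x *\<^sub>R (u x * v x)) =
        (\<lambda>x. indicator Lam x *\<^sub>R (u x * v x * indicator {0<..b} x))"
      by (auto simp: indicator_def)
    then show ?thesis
      by (subst (1 2) integral_restrict_space) (simp_all del: real_scaleR_def)
  qed
  moreover have "((\<lambda>b. LINT x|lebesgue_on Lam. u x * v x * indicator {0<..b} x) \<longlongrightarrow> L2_inner u v) at_top"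
    unfolding L2_inner_def
  proof (rule integral_dominated_convergence_at_top[where w = "\<lambda>x. \<bar>u x * v x\<bar>"])
    show "integrable (lebesgue_on Lam) (\<lambda>x. \<bar>u x * v x\<bar>)"
      by (intro integrable_abs L2_mult_integrable assms)
    show "(\<lambda>x. u x * v x) \<in> borel_measurable (lebesgue_on Lam)"
      by (intro borel_measurable_times L2_measurable assms)
    show "(\<lambda>x. u x * v x * indicator {0<..b} x) \<in> borel_measurable (lebesgue_on Lam)" for b
      by (intro borel_measurable_times L2_measurable assms interval_indicator_L2)
    show "\<forall>\<^sub>F b in at_top. AE x in lebesgue_on Lam. norm (u x * v x * indicator {0<..b} x) \<le> \<bar>u x * v x\<bar>"
      by (intro always_eventually allI AE_I2) (auto simp: indicator_def)
    show "AE x in lebesgue_on Lam. ((\<lambda>b. u x * v x * indicator {0<..b} x) \<longlongrightarrow> u x * v x) at_top"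
    proof (rule AE_I2, rule tendsto_eventually)
      fix x assume "x \<in> space (lebesgue_on Lam)"
      then have x: "0 < x" by simp
      show "\<forall>\<^sub>F b in at_top. u x * v x * indicator {0<..b} x = u x * v x"
        using eventually_ge_at_top[of x] by eventually_elim (use x in \<open>auto simp: indicator_def\<close>)
    qed
  qed
  ultimately show ?thesis by simp
qed

text \<open>
  Used to see that the boundary term \<open>u b * v b\<close> at infinity vanishes.
\<close>

lemma integrable_Lam_limit_0:
  fixes h :: "real \<Rightarrow> real"
  assumes "integrable (lebesgue_on Lam) h" and lim: "(h \<longlongrightarrow> l) at_top"
  shows "l = 0"
proof (rule ccontr)
  assume l: "l \<noteq> 0"
  then have "\<forall>\<^sub>F x in at_top. dist (h x) l < \<bar>l\<bar> / 2"
    using lim by (intro tendstoD) auto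
  then obtain M where M: "\<And>x. M \<le> x \<Longrightarrow> \<bar>h x - l\<bar> < \<bar>l\<bar> / 2"
    unfolding eventually_at_top_linorder dist_real_def by blast
  define m where "m = max M 1"
  have low: "\<bar>l\<bar> / 2 \<le> \<bar>h x\<bar>" if "m \<le> x" for x
    using M[of x] that unfolding m_def by linarith
  define I where "I = (LINT x|lebesgue_on Lam. \<bar>h x\<bar>)"
  have "\<bar>l\<bar> / 2 * t \<le> I" if t: "0 \<le> t" for t
  proof -
    have eq: "(\<lambda>x. indicator Lam x *\<^sub>R (\<bar>l\<bar> / 2 * indicator {m<..m+t} x)) = (\<lambda>x. indicator {m<..m+t} x *\<^sub>R (\<bar>l\<bar> / 2))"
      by (auto simp: indicator_def m_def)
    have "(LINT x|lebesgue_on Lam. \<bar>l\<bar> / 2 * indicator {m<..m+t} x) = (LINT x|lebesgue_on {m<..m+t}. \<bar>l\<bar> / 2)"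
      by (subst (1 2) integral_restrict_space) (simp_all only: eq, simp_all)
    also have "\<dots> = \<bar>l\<bar> / 2 * t"
      using t by (simp add: measure_restrict_space)
    finally have "\<bar>l\<bar> / 2 * t = (LINT x|lebesgue_on Lam. \<bar>l\<bar> / 2 * indicator {m<..m+t} x)" ..
    also have "\<dots> \<le> I"
      unfolding I_def
    proof (rule integral_mono)
      have "integrable (lebesgue_on Lam) (\<lambda>x. indicator {m<..m+t} x * indicator {m<..m+t} x :: real)"
        by (intro L2_mult_integrable interval_indicator_L2)
      then show "integrable (lebesgue_on Lam) (\<lambda>x. \<bar>l\<bar> / 2 * indicator {m<..m+t} x)"
        by (simp flip: indicator_inter_arith)
      show "\<bar>l\<bar> / 2 * indicator {m<..m+t} x \<le> \<bar>h x\<bar>" for x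
        using low[of x] by (auto simp: indicator_def)
    qed (use assms in simp)
    finally show ?thesis .
  qed
  from this[of "2 * (\<bar>I\<bar> + 1) / \<bar>l\<bar>"] show False using l by simp
qed

text \<open>
  On \<open>(0,b]\<close> the left-hand side is \<open>u b * v b - u 0 * v 0\<close>. So \<open>u b * v b\<close> converges as
  \<open>b\<close> grows, and as \<open>u v\<close> is integrable its limit can only be \<open>0\<close>.
\<close>

theorem H1_integration_by_parts:
  assumes u: "u \<in> H1" and v: "v \<in> H1"
  shows "L2_inner (wderiv u) v + L2_inner u (wderiv v) = - (u 0 * v 0)"
proof -
  have fin: "(LINT x|lebesgue_on {0<..b}. wderiv u x * v x) + (LINT x|lebesgue_on {0<..b}. u x * wderiv v x)
      = u b * v b - u 0 * v 0" if b: "0 \<le> b" for b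
  proof -
    have incr: "L2_inner (wderiv w) (indicator {0<..x}) = w x - w 0" if "w \<in> H1" "0 \<le> x" for w x
      using H1_increment[OF that(1), of 0 x] that(2) by simp
    have int: "integrable (lebesgue_on {0<..b}) (\<lambda>x. g x * w x)" if "g \<in> L2" "w \<in> L2" for g w
    proof -
      have "(\<lambda>x. indicator Lam x *\<^sub>R (g x * w x * indicator {0<..b} x)) = (\<lambda>x. indicator {0<..b} x *\<^sub>R (g x * w x))"
        by (auto simp: indicator_def)
      moreover have "integrable (lebesgue_on Lam) (\<lambda>x. g x * w x * indicator {0<..b} x)"
        by (rule Bochner_Integration.integrable_bound[OF L2_mult_integrable[OF that]])
          (auto intro!: AE_I2 borel_measurable_times that[THEN L2_measurable]
             interval_indicator_L2[THEN L2_measurable] split: split_indicator)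
      ultimately show ?thesis
        by (simp add: integrable_restrict_space del: real_scaleR_def)
    qed
    have one: "integrable (lebesgue_on {0<..b}) g \<and> integral\<^sup>L (lebesgue_on {0<..b}) g = L2_inner g (indicator {0<..b})" if "g \<in> L2" for g
    proof -
      have "integrable (lebesgue_on {0<..b}) (\<lambda>x. g x * indicator {0<..b} x)"
        using that by (intro int interval_indicator_L2)
      then have "integrable (lebesgue_on {0<..b}) g"
        by (rule Bochner_Integration.integrable_cong[THEN iffD1, rotated -1]) auto
      moreover have "integral\<^sup>L (lebesgue_on {0<..b}) g = L2_inner g (indicator {0<..b})"
        unfolding L2_inner_interval[OF b order_refl]
        by (intro Bochner_Integration.integral_cong) (auto simp: indicator_def)
      ultimately show ?thesis by simp
    qed
    have half: "(LINT x|lebesgue_on {0<..b}. wderiv w x * (L2_inner (wderiv z) (indicator {0<..x})))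
        = (LINT x|lebesgue_on {0<..b}. wderiv w x * z x) - z 0 * (w b - w 0)" if "w \<in> H1" "z \<in> H1" for w z
    proof -
      have "(LINT x|lebesgue_on {0<..b}. wderiv w x * (L2_inner (wderiv z) (indicator {0<..x})))
          = (LINT x|lebesgue_on {0<..b}. wderiv w x * z x - z 0 * wderiv w x)"
        using that by (intro Bochner_Integration.integral_cong refl) (simp add: incr algebra_simps)
      also have "\<dots> = (LINT x|lebesgue_on {0<..b}. wderiv w x * z x) - z 0 * (w b - w 0)"
        using int[OF H1_wderiv(1)[OF that(1)] H1_L2[OF that(2)]] one[OF H1_wderiv(1)[OF that(1)]] incr[OF that(1) b]
        by simp
      finally show ?thesis .
    qed
    show ?thesis
      using product_of_primitives[OF H1_wderiv(1)[OF u] H1_wderiv(1)[OF v] b]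
      unfolding half[OF u v] half[OF v u] incr[OF u b] incr[OF v b]
      by (simp add: mult.commute[of "wderiv v _"] algebra_simps)
  qed
  have "((\<lambda>b. (LINT x|lebesgue_on {0<..b}. wderiv u x * v x) + (LINT x|lebesgue_on {0<..b}. u x * wderiv v x)
      + u 0 * v 0) \<longlongrightarrow> L2_inner (wderiv u) v + L2_inner u (wderiv v) + u 0 * v 0) at_top"
    by (intro tendsto_add tendsto_const tendsto_L2_inner_truncated H1_wderiv H1_L2 u v)
  then have "((\<lambda>b. u b * v b) \<longlongrightarrow> L2_inner (wderiv u) v + L2_inner u (wderiv v) + u 0 * v 0) at_top"
    by (rule Lim_transform_eventually) (rule eventually_mono[OF eventually_ge_at_top[of 0]], simp add: fin)
  then have "L2_inner (wderiv u) v + L2_inner u (wderiv v) + u 0 * v 0 = 0"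
    by (rule integrable_Lam_limit_0[OF L2_mult_integrable[OF H1_L2[OF u] H1_L2[OF v]]])
  then show ?thesis by simp
qed

section \<open>Exponential polynomials\<close>

text \<open>
  The elements of \<open>X \<beta> n\<close> are the functions \<open>expoly (\<beta> / 2) p\<close>. Other decay rates occur in
  the proof of density.
\<close>

definition expoly :: "real \<Rightarrow> real poly \<Rightarrow> real \<Rightarrow> real" where
  "expoly a p x = exp (- a * x) * poly p x"

lemma X_eq_expoly: "X \<beta> n = {expoly (\<beta> / 2) p | p. p = 0 \<or> int (degree p) \<le> n}"
  by (auto simp: X_def expoly_def fun_eq_iff)

lemma expoly_has_derivative:
  "(expoly a p has_real_derivative expoly a (pderiv p - smult a p) x) (at x)"
proof -
  have "((\<lambda>x. exp (- a * x) * poly p x) has_real_derivative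
      exp (- a * x) * (- a) * poly p x + poly (pderiv p) x * exp (- a * x)) (at x)"
    by (intro DERIV_mult poly_DERIV DERIV_fun_exp) (auto intro!: derivative_eq_intros)
  then show ?thesis
    unfolding expoly_def[abs_def] by (simp add: algebra_simps)
qed

lemma expoly_continuous: "continuous_on A (expoly a p)"
  using expoly_has_derivative by (meson DERIV_isCont continuous_at_imp_continuous_on)

lemma expoly_measurable: "expoly a p \<in> borel_measurable (lebesgue_on Lam)"
  by (intro borel_measurable_lebesgue_on_Lam borel_measurable_continuous_onI expoly_continuous)

lemma exp_L2:
  assumes "0 < a"
  shows "(\<lambda>x. exp (- a * x)) \<in> L2"
proof (rule L2I)
  have meas: "(\<lambda>x. exp (- c * x)) \<in> borel_measurable (lebesgue_on Lam)" for c :: real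
    by (intro borel_measurable_lebesgue_on_Lam) measurable
  then show "(\<lambda>x. exp (- a * x)) \<in> borel_measurable (lebesgue_on Lam)" .
  have "(\<lambda>x. exp (- (2 * a) * x)) integrable_on {0..}"
    using assms by (intro integrable_on_exp_minus_to_infinity) simp
  then have "(\<lambda>x. exp (- (2 * a) * x)) absolutely_integrable_on {0..}"
    by (intro nonnegative_absolutely_integrable_1) auto
  then have "(\<lambda>x. exp (- (2 * a) * x)) absolutely_integrable_on Lam"
    by (rule set_integrable_subset) auto
  then have "integrable (lebesgue_on Lam) (\<lambda>x. exp (- (2 * a) * x))"
    by (simp add: set_integrable_def integrable_restrict_space)
  moreover have "(exp (- a * x))\<^sup>2 = exp (- (2 * a) * x)" for x
    by (simp add: power2_eq_square exp_add[symmetric])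
  ultimately show "integrable (lebesgue_on Lam) (\<lambda>x. (exp (- a * x))\<^sup>2)" by simp
qed

text \<open>
  Each factor \<open>x\<close> is paid for with half of the decay rate, since
  \<open>x \<le> 2 / a * exp (a / 2 * x)\<close>.
\<close>

lemma expoly_L2: "0 < a \<Longrightarrow> expoly a p \<in> L2"
proof (induction p arbitrary: a)
  case 0
  then show ?case using L2_zero by (simp add: expoly_def[abs_def])
next
  case (pCons c p)
  have "(\<lambda>x. x * expoly a p x) \<in> L2"
  proof (rule L2_bounded)
    show "(\<lambda>x. x * expoly a p x) \<in> borel_measurable (lebesgue_on Lam)"
      by (intro borel_measurable_times expoly_measurable borel_measurable_lebesgue_on_Lam) simp
    have "(\<lambda>x. \<bar>expoly (a / 2) p x\<bar>) \<in> L2"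
      using pCons.IH[of "a / 2"] pCons.prems
      by (intro L2I) (auto dest: L2_measurable L2_square_integrable)
    then show "(\<lambda>x. 2 / a * \<bar>expoly (a / 2) p x\<bar>) \<in> L2" by (rule L2_scale)
    show "AE x in lebesgue_on Lam. \<bar>x * expoly a p x\<bar> \<le> 2 / a * \<bar>expoly (a / 2) p x\<bar>"
    proof (rule AE_I2)
      fix x assume "x \<in> space (lebesgue_on Lam)"
      then have x: "0 < x" by simp
      have "a / 2 * x \<le> exp (a / 2 * x)" using exp_ge_add_one_self[of "a / 2 * x"] by linarith
      then have "x \<le> 2 / a * exp (a / 2 * x)" using pCons.prems by (simp add: field_simps)
      then have "x * exp (- a * x) \<le> 2 / a * exp (a / 2 * x) * exp (- a * x)"
        by (rule mult_right_mono) simp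
      also have "\<dots> = 2 / a * exp (- (a / 2) * x)"
        by (simp add: mult.assoc exp_add[symmetric])
      finally have "x * exp (- a * x) * \<bar>poly p x\<bar> \<le> 2 / a * exp (- (a / 2) * x) * \<bar>poly p x\<bar>"
        by (rule mult_right_mono) simp
      then show "\<bar>x * expoly a p x\<bar> \<le> 2 / a * \<bar>expoly (a / 2) p x\<bar>"
        using x by (simp add: expoly_def abs_mult mult.assoc)
    qed
  qed
  then have "(\<lambda>x. c * exp (- a * x) + x * expoly a p x) \<in> L2"
    using pCons.prems by (intro L2_add L2_scale exp_L2)
  then show ?case
    by (simp add: expoly_def[abs_def] algebra_simps)
qed

lemma expoly_weak_deriv: "is_weak_deriv (expoly a p) (expoly a (pderiv p - smult a p))"
  by (intro is_weak_deriv_classical expoly_has_derivative expoly_continuous)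

lemma expoly_H1: "0 < a \<Longrightarrow> expoly a p \<in> H1"
  by (rule H1I[OF _ _ _ expoly_weak_deriv]) (auto intro: expoly_continuous expoly_L2)

lemma expoly_add: "expoly a (p + q) = (\<lambda>x. expoly a p x + expoly a q x)"
  and expoly_diff: "expoly a (p - q) = (\<lambda>x. expoly a p x - expoly a q x)"
  and expoly_smult: "expoly a (smult c p) = (\<lambda>x. c * expoly a p x)"
  and expoly_0: "expoly a 0 = (\<lambda>x. 0)"
  by (simp_all add: expoly_def fun_eq_iff algebra_simps)

text \<open>
  On \<open>expoly a\<close> the operator \<open>v \<mapsto> v' - s * v\<close> acts as \<open>p \<mapsto> p' - (a + s) * p\<close> on polynomials.
  So first-order equations with such a right-hand side are solvable without raising the degree.
\<close>

lemma pderiv_minus_smult_surj: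
  fixes q :: "real poly"
  assumes "c \<noteq> 0"
  shows "\<exists>p. degree p \<le> degree q \<and> pderiv p - smult c p = q"
proof (induction "degree q" arbitrary: q rule: less_induct)
  case less
  show ?case
  proof (cases "degree q = 0")
    case True
    then obtain k where "q = [:k:]" using degree_eq_zeroE by blast
    then show ?thesis using assms by (intro exI[of _ "[:- k / c:]"]) (simp add: pderiv_pCons)
  next
    case False
    then have "degree (pderiv q) < degree q" by (simp add: degree_pderiv)
    moreover have deg: "degree (smult (1 / c) (pderiv q)) = degree (pderiv q)" using assms by simp
    ultimately obtain r where r: "degree r \<le> degree (pderiv q)" "pderiv r - smult c r = smult (1 / c) (pderiv q)"
      using less[of "smult (1 / c) (pderiv q)"] by (metis deg)
    have "degree (smult (- 1 / c) q + r) \<le> degree q"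
      using r(1) \<open>degree (pderiv q) < degree q\<close> by (intro degree_add_le) auto
    \<comment> \<open>with \<open>p = - q / c + r\<close> the remaining equation for \<open>r\<close> has a right-hand side of smaller degree\<close>
    moreover have "pderiv (smult (- 1 / c) q + r) - smult c (smult (- 1 / c) q + r) =
        smult (- 1 / c) (pderiv q) + q + (pderiv r - smult c r)"
      using assms by (simp add: pderiv_add pderiv_diff pderiv_smult smult_add_right smult_diff_right)
    moreover have "smult (- 1 / c) (pderiv q) + smult (1 / c) (pderiv q) = 0"
      by (simp flip: smult_add_left)
    ultimately show ?thesis
      unfolding r(2) by (intro exI[of _ "smult (- 1 / c) q + r"]) (simp only: add.assoc add.commute add.left_commute add_0_left)
  qed
qed

section \<open>Density of the exponential polynomials\<close>

definition L2_closure :: "(real \<Rightarrow> real) set \<Rightarrow> (real \<Rightarrow> real) set" where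
  "L2_closure S = {f \<in> L2. \<forall>e>0. \<exists>v\<in>S. L2_inner (\<lambda>x. f x - v x) (\<lambda>x. f x - v x) < e}"

lemma L2_closure_trans:
  assumes f: "f \<in> L2" and S: "S \<subseteq> L2"
    and approx: "\<And>e. 0 < e \<Longrightarrow> \<exists>g\<in>L2_closure S. L2_inner (\<lambda>x. f x - g x) (\<lambda>x. f x - g x) < e"
  shows "f \<in> L2_closure S"
proof -
  have "\<exists>v\<in>S. L2_inner (\<lambda>x. f x - v x) (\<lambda>x. f x - v x) < e" if "0 < e" for e
  proof -
    have e4: "0 < e / 4" using that by simp
    obtain g where g: "g \<in> L2_closure S" "L2_inner (\<lambda>x. f x - g x) (\<lambda>x. f x - g x) < e / 4"
      using approx[OF e4] by blast
    obtain v where v: "v \<in> S" "L2_inner (\<lambda>x. g x - v x) (\<lambda>x. g x - v x) < e / 4"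
      using g(1) e4 unfolding L2_closure_def by blast
    have "g \<in> L2" "v \<in> L2" using g v S by (auto simp: L2_closure_def)
    then have "L2_inner (\<lambda>x. (f x - g x) + (g x - v x)) (\<lambda>x. (f x - g x) + (g x - v x)) < e"
      using L2.norm_add_le[OF L2.diff_mem[OF f \<open>g \<in> L2\<close>] L2.diff_mem[OF \<open>g \<in> L2\<close> \<open>v \<in> L2\<close>]] g(2) v(2)
      by linarith
    then show ?thesis using v(1) by auto
  qed
  then show ?thesis using f by (simp add: L2_closure_def)
qed

lemma L2_closure_superset: "v \<in> S \<Longrightarrow> S \<subseteq> L2 \<Longrightarrow> v \<in> L2_closure S"
  unfolding L2_closure_def by (auto intro!: bexI[of _ v] simp: L2_inner_def)

lemma L2_closure_limit:
  assumes S: "S \<subseteq> L2" and s: "\<And>n. s n \<in> L2_closure S" and fg: "f \<in> L2" "g \<in> L2"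
    and lim: "AE x in lebesgue_on Lam. (\<lambda>n. s n x) \<longlonglongrightarrow> f x"
    and dom: "\<And>n. AE x in lebesgue_on Lam. \<bar>s n x\<bar> \<le> g x"
  shows "f \<in> L2_closure S"
proof (rule L2_closure_trans[OF fg(1) S])
  fix e :: real assume "0 < e"
  have sL2: "s n \<in> L2" for n using s[of n] by (simp add: L2_closure_def)
  have bound: "AE x in lebesgue_on Lam. \<bar>f x\<bar> \<le> g x"
  proof -
    have "AE x in lebesgue_on Lam. \<forall>n. \<bar>s n x\<bar> \<le> g x" using dom by (simp add: AE_all_countable)
    with lim show ?thesis
    proof eventually_elim
      case (elim x)
      then show ?case using tendsto_rabs[OF elim(1)] by (intro LIMSEQ_le_const2) auto
    qed
  qed
  have "(\<lambda>n. L2_inner (\<lambda>x. f x - s n x) (\<lambda>x. f x - s n x)) \<longlonglongrightarrow> (LINT x|lebesgue_on Lam. 0)"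
    unfolding L2_inner_def
  proof (rule integral_dominated_convergence[where w = "\<lambda>x. (2 * g x)\<^sup>2"])
    show "(\<lambda>x. (f x - s n x) * (f x - s n x)) \<in> borel_measurable (lebesgue_on Lam)" for n
      by (intro borel_measurable_times borel_measurable_diff L2_measurable fg sL2)
    show "integrable (lebesgue_on Lam) (\<lambda>x. (2 * g x)\<^sup>2)"
      by (intro L2_square_integrable L2_scale fg)
    show "AE x in lebesgue_on Lam. norm ((f x - s n x) * (f x - s n x)) \<le> (2 * g x)\<^sup>2" for n
      using bound dom[of n]
    proof eventually_elim
      case (elim x)
      then have "\<bar>f x - s n x\<bar> \<le> 2 * g x" by linarith
      then have "\<bar>f x - s n x\<bar>\<^sup>2 \<le> (2 * g x)\<^sup>2" by (intro power_mono) auto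
      then show ?case by (simp add: power2_eq_square abs_mult)
    qed
    show "AE x in lebesgue_on Lam. (\<lambda>n. (f x - s n x) * (f x - s n x)) \<longlonglongrightarrow> 0"
      using lim
    proof eventually_elim
      case (elim x)
      have "(\<lambda>n. (f x - s n x) * (f x - s n x)) \<longlonglongrightarrow> (f x - f x) * (f x - f x)"
        by (intro tendsto_intros elim)
      then show ?case by simp
    qed
  qed simp
  then have "\<forall>\<^sub>F n in sequentially. L2_inner (\<lambda>x. f x - s n x) (\<lambda>x. f x - s n x) < e"
    using \<open>0 < e\<close> by (intro order_tendstoD) auto
  then obtain n where "L2_inner (\<lambda>x. f x - s n x) (\<lambda>x. f x - s n x) < e"
    using eventually_happens'[OF sequentially_bot] by blast
  then show "\<exists>g\<in>L2_closure S. L2_inner (\<lambda>x. f x - g x) (\<lambda>x. f x - g x) < e"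
    using s[of n] by blast
qed

lemma L2_closure_add:
  assumes S: "S \<subseteq> L2" "\<And>u v. \<lbrakk>u \<in> S; v \<in> S\<rbrakk> \<Longrightarrow> (\<lambda>x. u x + v x) \<in> S"
    and uv: "u \<in> L2_closure S" "v \<in> L2_closure S"
  shows "(\<lambda>x. u x + v x) \<in> L2_closure S"
proof -
  have L2: "u \<in> L2" "v \<in> L2" using uv by (auto simp: L2_closure_def)
  have "\<exists>w\<in>S. L2_inner (\<lambda>x. u x + v x - w x) (\<lambda>x. u x + v x - w x) < e" if "0 < e" for e
  proof -
    have "0 < e / 4" using \<open>0 < e\<close> by simp
    then obtain u' v' where *: "u' \<in> S" "L2_inner (\<lambda>x. u x - u' x) (\<lambda>x. u x - u' x) < e / 4"
      "v' \<in> S" "L2_inner (\<lambda>x. v x - v' x) (\<lambda>x. v x - v' x) < e / 4"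
      using uv unfolding L2_closure_def by blast
    have "L2_inner (\<lambda>x. (u x - u' x) + (v x - v' x)) (\<lambda>x. (u x - u' x) + (v x - v' x)) < e"
      using L2.norm_add_le[OF L2.diff_mem[OF L2(1), of u'] L2.diff_mem[OF L2(2), of v']] * S(1) by fastforce
    then have "L2_inner (\<lambda>x. u x + v x - (u' x + v' x)) (\<lambda>x. u x + v x - (u' x + v' x)) < e"
      by (simp add: algebra_simps)
    then show ?thesis using S(2)[OF *(1,3)] by (intro bexI[of _ "\<lambda>x. u' x + v' x"])
  qed
  then show ?thesis using L2_add[OF L2] by (simp add: L2_closure_def)
qed

lemma L2_closure_scale:
  assumes S: "S \<subseteq> L2" "\<And>c u. u \<in> S \<Longrightarrow> (\<lambda>x. c * u x) \<in> S"
    and u: "u \<in> L2_closure S"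
  shows "(\<lambda>x. c * u x) \<in> L2_closure S"
proof -
  have L2: "u \<in> L2" using u by (auto simp: L2_closure_def)
  have "\<exists>w\<in>S. L2_inner (\<lambda>x. c * u x - w x) (\<lambda>x. c * u x - w x) < e" if "0 < e" for e
  proof -
    have pos: "0 < c\<^sup>2 + 1" by (simp add: add_nonneg_pos)
    then have "0 < e / (c\<^sup>2 + 1)" using \<open>0 < e\<close> by simp
    then obtain v where v: "v \<in> S" "L2_inner (\<lambda>x. u x - v x) (\<lambda>x. u x - v x) < e / (c\<^sup>2 + 1)"
      using u unfolding L2_closure_def by blast
    define d where "d = (\<lambda>x. u x - v x)"
    have d: "d \<in> L2" unfolding d_def using L2 v S(1) by (intro L2.diff_mem) auto
    have "L2_inner (\<lambda>x. c * d x) (\<lambda>x. c * d x) = c\<^sup>2 * L2_inner d d"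
      by (simp add: L2_inner_def power2_eq_square mult_ac flip: integral_mult_right_zero)
    also have "\<dots> \<le> (c\<^sup>2 + 1) * L2_inner d d"
      using L2.nonneg[OF d] by (intro mult_right_mono) auto
    also have "\<dots> < e" using v(2) pos unfolding d_def by (simp add: field_simps)
    finally have "L2_inner (\<lambda>x. c * u x - c * v x) (\<lambda>x. c * u x - c * v x) < e"
      unfolding d_def by (simp add: right_diff_distrib)
    then show ?thesis using S(2)[OF v(1)] by (intro bexI[of _ "\<lambda>x. c * v x"])
  qed
  then show ?thesis using L2_scale[OF L2] by (simp add: L2_closure_def)
qed

text \<open>
  Expand \<open>exp ((a - b) * x)\<close> in its power series. The partial sums, multiplied by
  \<open>exp (- a * x)\<close>, are dominated by \<open>exp (- (a - \<bar>a - b\<bar>) * x)\<close>, which decays precisely because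
  \<open>\<bar>b - a\<bar> < a\<close>.
\<close>

lemma expoly_closure_step:
  assumes "0 < a" "\<bar>b - a\<bar> < a"
  shows "expoly b p \<in> L2_closure (range (expoly a))"
proof (rule L2_closure_limit)
  define q where "q n = (\<Sum>k<n. monom ((a - b) ^ k / fact k) k)" for n
  have q: "poly (q n) x = (\<Sum>k<n. ((a - b) * x) ^ k / fact k)" for n x
    by (simp add: q_def poly_sum poly_monom power_mult_distrib)
  show sub: "range (expoly a) \<subseteq> L2" using assms expoly_L2 by auto
  show "expoly a (p * q n) \<in> L2_closure (range (expoly a))" for n
    using sub by (intro L2_closure_superset) auto
  show "expoly b p \<in> L2" using assms by (intro expoly_L2) linarith
  have "expoly (a - \<bar>a - b\<bar>) p \<in> L2" using assms by (intro expoly_L2) linarith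
  then show "(\<lambda>x. \<bar>expoly (a - \<bar>a - b\<bar>) p x\<bar>) \<in> L2"
    by (intro L2I) (auto dest: L2_measurable L2_square_integrable)
  show "AE x in lebesgue_on Lam. (\<lambda>n. expoly a (p * q n) x) \<longlonglongrightarrow> expoly b p x"
  proof (rule AE_I2)
    fix x
    have "(\<lambda>n. poly (q n) x) \<longlonglongrightarrow> exp ((a - b) * x)"
      using exp_converges[of "(a - b) * x"] unfolding q sums_def by (simp add: divide_inverse mult.commute)
    then have "(\<lambda>n. exp (- a * x) * (poly p x * poly (q n) x)) \<longlonglongrightarrow> exp (- a * x) * (poly p x * exp ((a - b) * x))"
      by (intro tendsto_intros)
    moreover have "exp (- a * x) * exp ((a - b) * x) = exp (- b * x)"
      by (simp add: exp_add[symmetric] algebra_simps)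
    then have "exp (- a * x) * (poly p x * exp ((a - b) * x)) = expoly b p x"
      unfolding expoly_def by (metis mult.assoc mult.commute)
    ultimately show "(\<lambda>n. expoly a (p * q n) x) \<longlonglongrightarrow> expoly b p x"
      by (simp only: expoly_def poly_mult)
  qed
  show "AE x in lebesgue_on Lam. \<bar>expoly a (p * q n) x\<bar> \<le> \<bar>expoly (a - \<bar>a - b\<bar>) p x\<bar>" for n
  proof (rule AE_I2)
    fix x assume "x \<in> space (lebesgue_on Lam)"
    then have x: "0 < x" by simp
    have "\<bar>poly (q n) x\<bar> \<le> (\<Sum>k<n. (\<bar>a - b\<bar> * x) ^ k / fact k)"
      unfolding q using x by (intro order_trans[OF sum_abs] sum_mono) (simp add: power_abs abs_mult)
    also have "\<dots> \<le> exp (\<bar>a - b\<bar> * x)"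
      unfolding exp_def using summable_exp[of "\<bar>a - b\<bar> * x"] x
      by (intro order_trans[OF _ sum_le_suminf[of _ "{..<n}"]] sum_mono) (auto simp: divide_inverse mult.commute)
    finally have "exp (- a * x) * \<bar>poly p x\<bar> * \<bar>poly (q n) x\<bar> \<le> exp (- a * x) * \<bar>poly p x\<bar> * exp (\<bar>a - b\<bar> * x)"
      by (rule mult_left_mono) simp
    moreover have "exp (- (a - \<bar>a - b\<bar>) * x) = exp (- a * x) * exp (\<bar>a - b\<bar> * x)"
      by (simp add: exp_add[symmetric] algebra_simps)
    ultimately show "\<bar>expoly a (p * q n) x\<bar> \<le> \<bar>expoly (a - \<bar>a - b\<bar>) p x\<bar>"
      by (simp add: expoly_def abs_mult mult_ac)
  qed
qed

lemma Weierstrass_poly: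
  fixes k :: "real \<Rightarrow> real"
  assumes "continuous_on {0..1} k" "0 < e"
  shows "\<exists>q. \<forall>t\<in>{0..1}. \<bar>k t - poly q t\<bar> < e"
proof -
  obtain n where n: "\<And>t. t \<in> {0..1} \<Longrightarrow> \<bar>k t - (\<Sum>i\<le>n. k (real i / real n) * Bernstein n i t)\<bar> < e"
    using Bernstein_Weierstrass[OF assms] by blast
  define q where "q = (\<Sum>i\<le>n. smult (k (real i / real n) * real (n choose i)) (monom 1 i * [:1, -1:] ^ (n - i)))"
  have "poly q t = (\<Sum>i\<le>n. k (real i / real n) * Bernstein n i t)" for t
    by (simp add: q_def poly_sum poly_monom Bernstein_def poly_power mult.assoc)
  then show ?thesis using n by (intro exI[of _ q]) simp
qed

text \<open>
  A single power series step from the rate \<open>a\<close> stays below \<open>2 * a\<close>, so all rates are reached by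
  small steps. Starting at \<open>2 * \<delta>\<close> with step width \<open>\<delta>\<close>, every step is admissible.
\<close>

lemma expoly_closure_arithmetic:
  assumes "0 < \<delta>"
  shows "expoly (\<delta> * (real j + 2)) p \<in> L2_closure (range (expoly (2 * \<delta>)))"
proof (induction j arbitrary: p)
  case 0
  show ?case
    using assms expoly_L2 by (intro L2_closure_superset) (auto simp: mult.commute)
next
  case (Suc j)
  let ?a = "\<delta> * (real j + 2)" and ?b = "\<delta> * (real (Suc j) + 2)"
  have a: "0 < ?a" using assms by (simp add: add_nonneg_pos)
  have ba: "?b - ?a = \<delta>" by (simp add: algebra_simps)
  have "\<delta> * 1 < \<delta> * (real j + 2)" using assms by (intro mult_strict_left_mono) auto
  then have "\<bar>?b - ?a\<bar> < ?a" using assms ba by simp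
  from expoly_closure_step[OF a this]
  have step: "expoly ?b p \<in> L2_closure (range (expoly ?a))" .
  show ?case
  proof (rule L2_closure_trans)
    show "expoly ?b p \<in> L2" using step by (simp add: L2_closure_def)
    show "range (expoly (2 * \<delta>)) \<subseteq> L2" using assms expoly_L2 by auto
    fix e :: real assume "0 < e"
    then obtain v where "v \<in> range (expoly ?a)" "L2_inner (\<lambda>x. expoly ?b p x - v x) (\<lambda>x. expoly ?b p x - v x) < e"
      using step unfolding L2_closure_def by blast
    then show "\<exists>g\<in>L2_closure (range (expoly (2 * \<delta>))). L2_inner (\<lambda>x. expoly ?b p x - g x) (\<lambda>x. expoly ?b p x - g x) < e"
      using Suc.IH by blast
  qed
qed

lemma range_expoly_add: "u \<in> range (expoly a) \<Longrightarrow> v \<in> range (expoly a) \<Longrightarrow> (\<lambda>x. u x + v x) \<in> range (expoly a)"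
  by (auto simp flip: expoly_add)

lemma range_expoly_scale: "u \<in> range (expoly a) \<Longrightarrow> (\<lambda>x. c * u x) \<in> range (expoly a)"
  by (auto simp flip: expoly_smult)

lemma exponential_sum_in_closure:
  assumes "0 < \<delta>"
  shows "(\<lambda>x. exp (- (2 * \<delta>) * x) * poly q (exp (- \<delta> * x))) \<in> L2_closure (range (expoly (2 * \<delta>)))"
proof -
  let ?C = "L2_closure (range (expoly (2 * \<delta>)))"
  have sub: "range (expoly (2 * \<delta>)) \<subseteq> L2" using assms expoly_L2 by auto
  have add: "(\<lambda>x. u x + v x) \<in> ?C" if "u \<in> ?C" "v \<in> ?C" for u v
    using sub range_expoly_add that by (rule L2_closure_add)
  have scale: "(\<lambda>x. c * u x) \<in> ?C" if "u \<in> ?C" for c u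
    using sub range_expoly_scale that by (rule L2_closure_scale)
  have single: "(\<lambda>x. exp (- \<delta> * (real j + 2) * x)) \<in> ?C" for j
    using expoly_closure_arithmetic[OF assms, of j 1] by (simp add: expoly_def[abs_def])
  have "(\<lambda>x. \<Sum>j<n. coeff q j * exp (- \<delta> * (real j + 2) * x)) \<in> ?C" for n
  proof (induction n)
    case 0
    have "(\<lambda>x. 0) \<in> ?C"
      using sub by (intro L2_closure_superset) (auto simp flip: expoly_0[of "2 * \<delta>"])
    then show ?case by simp
  next
    case (Suc n)
    from add[OF Suc scale[OF single[of n]]] show ?case
      by (simp only: sum.lessThan_Suc)
  qed
  moreover have "exp (- (2 * \<delta>) * x) * poly q (exp (- \<delta> * x)) =
      (\<Sum>j<Suc (degree q). coeff q j * exp (- \<delta> * (real j + 2) * x))" for x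
  proof -
    have "exp (- (2 * \<delta>) * x) * exp (- \<delta> * x) ^ j = exp (- \<delta> * (real j + 2) * x)" for j
      by (simp add: exp_of_nat_mult[symmetric] exp_add[symmetric] algebra_simps)
    then show ?thesis
      unfolding poly_altdef sum_distrib_left lessThan_Suc_atMost
      by (intro sum.cong refl) (simp add: mult.left_commute)
  qed
  ultimately show ?thesis by (simp only:)
qed

text \<open>
  The substitution \<open>t = exp (- \<delta> * x)\<close> maps the half line to \<open>(0,1)\<close> and turns polynomials in \<open>t\<close>
  into exponential sums, so the Weierstrass theorem applies. The factor \<open>t\<^sup>2\<close> is split off first, so
  that uniform approximation of the quotient \<open>k\<close> becomes dominated approximation of \<open>h\<close>.
\<close>

lemma compact_support_in_closure:
  assumes \<delta>: "0 < \<delta>" and h: "continuous_on UNIV h" and S: "\<And>x. S \<le> x \<Longrightarrow> h x = 0" and L2: "h \<in> L2"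
  shows "h \<in> L2_closure (range (expoly (2 * \<delta>)))"
proof -
  have sub: "range (expoly (2 * \<delta>)) \<subseteq> L2" using \<delta> expoly_L2 by auto
  define \<tau> where "\<tau> = exp (- \<delta> * S)"
  \<comment> \<open>cutting off at \<open>\<tau>\<close> changes nothing, as \<open>h\<close> vanishes from \<open>S\<close> on, and makes continuity at \<open>0\<close> evident\<close>
  define k where "k t = h (- ln (max t \<tau>) / \<delta>) / (max t \<tau>)\<^sup>2" for t
  have \<tau>: "0 < \<tau>" by (simp add: \<tau>_def)
  have k_cont: "continuous_on {0..1} k"
  proof -
    have pos: "max t \<tau> \<noteq> 0" for t using \<tau> by (simp add: max_def)
    have "continuous_on {0..1} (\<lambda>t. h (- ln (max t \<tau>) / \<delta>))"
      by (rule continuous_on_compose2[OF h]) (use pos \<delta> in \<open>auto intro!: continuous_intros\<close>)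
    then show ?thesis
      unfolding k_def by (rule continuous_on_divide) (use pos in \<open>auto intro!: continuous_intros\<close>)
  qed
  have k_exp: "exp (- (2 * \<delta>) * x) * k (exp (- \<delta> * x)) = h x" for x
  proof (cases "x \<le> S")
    case True
    then have "\<tau> \<le> exp (- \<delta> * x)" using \<delta> by (simp add: \<tau>_def)
    then have "max (exp (- \<delta> * x)) \<tau> = exp (- \<delta> * x)" by simp
    moreover have "(exp (- \<delta> * x))\<^sup>2 = exp (- (2 * \<delta>) * x)"
      by (simp add: power2_eq_square exp_add[symmetric])
    ultimately show ?thesis using \<delta> by (simp add: k_def)
  next
    case False
    then have "exp (- \<delta> * x) \<le> \<tau>" using \<delta> by (simp add: \<tau>_def)
    then have "max (exp (- \<delta> * x)) \<tau> = \<tau>" by simp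
    moreover have "- ln \<tau> / \<delta> = S" using \<delta> by (simp add: \<tau>_def)
    ultimately have "k (exp (- \<delta> * x)) = 0" using S[of S] by (simp add: k_def)
    then show ?thesis using S[of x] False by simp
  qed
  obtain M where M: "\<And>t. t \<in> {0..1} \<Longrightarrow> \<bar>k t\<bar> \<le> M"
    using compact_imp_bounded[OF compact_continuous_image[OF k_cont compact_Icc]]
    unfolding bounded_iff by (metis image_eqI real_norm_def)
  obtain q where q: "\<And>n t. t \<in> {0..1} \<Longrightarrow> \<bar>k t - poly (q n) t\<bar> < 1 / (real n + 1)"
  proof -
    have "\<exists>q. \<forall>t\<in>{0..1}. \<bar>k t - poly q t\<bar> < 1 / (real n + 1)" for n
      by (rule Weierstrass_poly[OF k_cont]) simp
    then show ?thesis using that by metis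
  qed
  have unit: "exp (- \<delta> * x) \<in> {0..1}" if "0 < x" for x using \<delta> that by simp
  show ?thesis
  proof (rule L2_closure_limit[OF sub])
    show "(\<lambda>x. exp (- (2 * \<delta>) * x) * poly (q n) (exp (- \<delta> * x))) \<in> L2_closure (range (expoly (2 * \<delta>)))" for n
      by (rule exponential_sum_in_closure[OF \<delta>])
    show "(\<lambda>x. (M + 1) * exp (- (2 * \<delta>) * x)) \<in> L2"
      by (intro L2_scale exp_L2) (use \<delta> in simp)
    show "AE x in lebesgue_on Lam. (\<lambda>n. exp (- (2 * \<delta>) * x) * poly (q n) (exp (- \<delta> * x))) \<longlonglongrightarrow> h x"
    proof (rule AE_I2)
      fix x assume "x \<in> space (lebesgue_on Lam)"
      then have x: "0 < x" by simp
      have "(\<lambda>n. poly (q n) (exp (- \<delta> * x)) - k (exp (- \<delta> * x))) \<longlonglongrightarrow> 0"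
      proof (rule Lim_null_comparison)
        show "\<forall>\<^sub>F n in sequentially. norm (poly (q n) (exp (- \<delta> * x)) - k (exp (- \<delta> * x))) \<le> 1 / (real n + 1)"
          using q[OF unit[OF x]] by (intro always_eventually allI) (simp add: abs_minus_commute less_imp_le)
        show "(\<lambda>n. 1 / (real n + 1)) \<longlonglongrightarrow> 0" by real_asymp
      qed
      then have "(\<lambda>n. poly (q n) (exp (- \<delta> * x))) \<longlonglongrightarrow> k (exp (- \<delta> * x))"
        by (rule LIM_zero_cancel)
      from tendsto_mult_left[OF this, of "exp (- (2 * \<delta>) * x)"]
      show "(\<lambda>n. exp (- (2 * \<delta>) * x) * poly (q n) (exp (- \<delta> * x))) \<longlonglongrightarrow> h x"
        unfolding k_exp .
    qed
    show "AE x in lebesgue_on Lam. \<bar>exp (- (2 * \<delta>) * x) * poly (q n) (exp (- \<delta> * x))\<bar> \<le> (M + 1) * exp (- (2 * \<delta>) * x)" for n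
    proof (rule AE_I2)
      fix x assume "x \<in> space (lebesgue_on Lam)"
      then have x: "0 < x" by simp
      have "1 / (real n + 1) \<le> 1" by simp
      then have "\<bar>poly (q n) (exp (- \<delta> * x))\<bar> \<le> M + 1"
        using M[OF unit[OF x]] q[OF unit[OF x], of n] by linarith
      from mult_right_mono[OF this, of "exp (- (2 * \<delta>) * x)"]
      show "\<bar>exp (- (2 * \<delta>) * x) * poly (q n) (exp (- \<delta> * x))\<bar> \<le> (M + 1) * exp (- (2 * \<delta>) * x)"
        by (simp add: abs_mult mult.commute)
    qed
  qed (fact L2)
qed

text \<open>
  Completeness of the Laguerre functions. By \<open>L2_closed_subspace_eq\<close> only indicators of
  intervals remain, and these are dominated limits of trapezoidal functions.
\<close>

theorem expoly_dense_L2: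
  assumes "0 < a"
  shows "L2_closure (range (expoly a)) = L2"
proof (rule L2_closed_subspace_eq)
  have sub: "range (expoly a) \<subseteq> L2" using assms expoly_L2 by auto
  show "L2_closure (range (expoly a)) \<subseteq> L2" by (auto simp: L2_closure_def)
  show "(\<lambda>x. u x + v x) \<in> L2_closure (range (expoly a))"
    if "u \<in> L2_closure (range (expoly a))" "v \<in> L2_closure (range (expoly a))" for u v
    using sub range_expoly_add that by (rule L2_closure_add)
  show "(\<lambda>x. c * u x) \<in> L2_closure (range (expoly a))" if "u \<in> L2_closure (range (expoly a))" for u c
    using sub range_expoly_scale that by (rule L2_closure_scale)
  show lim: "f \<in> L2_closure (range (expoly a))"
    if "\<And>n. s n \<in> L2_closure (range (expoly a))" "f \<in> L2" "g \<in> L2"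
      "AE x in lebesgue_on Lam. (\<lambda>n. s n x) \<longlonglongrightarrow> f x" "\<And>n. AE x in lebesgue_on Lam. \<bar>s n x\<bar> \<le> g x"
    for s g f
    using sub that by (rule L2_closure_limit)
  fix p q :: real assume pq: "0 < p" "p < q"
  define ramp where "ramp c n x = max 0 (min 1 ((real n + 1) * (x - c)))" for c n x
  define h where "h n x = ramp p n x - ramp q n x" for n x
  have ramp_0: "ramp c n x = 0" if "x \<le> c" for c n x
  proof -
    have "(real n + 1) * (x - c) \<le> 0" using that by (intro mult_nonneg_nonpos) auto
    then show ?thesis by (simp add: ramp_def)
  qed
  have ramp_1: "ramp c n x = 1" if "c + 1 \<le> x" for c n x
  proof -
    have "1 * 1 \<le> (real n + 1) * (x - c)" using that by (intro mult_mono) auto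
    then show ?thesis by (simp add: ramp_def)
  qed
  have h0: "h n x = 0" if "x \<notin> {p..q+1}" for n x
    using that pq ramp_0[of x p n] ramp_0[of x q n] ramp_1[of p x n] ramp_1[of q x n] by (auto simp: h_def)
  have h_cont: "continuous_on A (h n)" for A n
    unfolding h_def ramp_def by (intro continuous_intros)
  have h_L2: "h n \<in> L2" for n
    by (rule L2_compact_support[OF pq(1) h_cont h0])
  show "indicator {p<..q} \<in> L2_closure (range (expoly a))"
  proof (rule lim[where s = h and g = "indicator {p<..q+2}"])
    show "h n \<in> L2_closure (range (expoly a))" for n
    proof -
      have "h n x = 0" if "q + 2 \<le> x" for x using that h0[of x n] by auto
      from compact_support_in_closure[OF _ h_cont this h_L2, of "a / 2"] assms show ?thesis by simp
    qed
    show "AE x in lebesgue_on Lam. (\<lambda>n. h n x) \<longlonglongrightarrow> indicator {p<..q} x"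
    proof (rule AE_I2)
      fix x
      have "(\<lambda>n. ramp c n x) \<longlonglongrightarrow> indicator {c<..} x" for c
      proof (rule tendsto_eventually)
        show "\<forall>\<^sub>F n in sequentially. ramp c n x = indicator {c<..} x"
        proof (cases "c < x")
          case True
          have "\<forall>\<^sub>F n in sequentially. 1 \<le> (real n + 1) * (x - c)" using True by real_asymp
          then show ?thesis by eventually_elim (use True in \<open>simp add: ramp_def\<close>)
        qed (use ramp_0 in simp)
      qed
      from tendsto_diff[OF this[of p] this[of q]]
      have "(\<lambda>n. h n x) \<longlonglongrightarrow> indicator {p<..} x - indicator {q<..} x" unfolding h_def .
      moreover have "indicator {p<..} x - indicator {q<..} x = (indicator {p<..q} x :: real)"
        using pq by (auto simp: indicator_def)
      ultimately show "(\<lambda>n. h n x) \<longlonglongrightarrow> indicator {p<..q} x" by simp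
    qed
    show "AE x in lebesgue_on Lam. \<bar>h n x\<bar> \<le> indicator {p<..q+2} x" for n
    proof (rule AE_I2)
      fix x
      have "\<bar>h n x\<bar> \<le> 1" unfolding h_def ramp_def by linarith
      moreover have "h n p = 0" using ramp_0[of p p n] ramp_0[of p q n] pq by (simp add: h_def)
      ultimately show "\<bar>h n x\<bar> \<le> indicator {p<..q+2} x"
        using h0[of x n] by (cases "x = p") (auto simp: indicator_def)
    qed
  qed (rule interval_indicator_L2)+
qed

text \<open>
  Density carries over from \<open>L\<^sup>2\<close> to \<open>H\<^sup>1\<close> through the operator \<open>w \<mapsto> w' - w\<close>. It maps the
  exponential polynomials onto themselves, and \<open>2 * (w', w) = - (w 0)\<^sup>2\<close> gives
  \<open>\<parallel>w' - w\<parallel>\<^sup>2 = \<parallel>w'\<parallel>\<^sup>2 + \<parallel>w\<parallel>\<^sup>2 + (w 0)\<^sup>2\<close>. Hence approximating \<open>u' - u\<close> in \<open>L\<^sup>2\<close> suffices to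
  approximate \<open>u\<close> in \<open>H\<^sup>1\<close> together with its trace.
\<close>

theorem expoly_dense_H1:
  assumes a: "0 < a" and u: "u \<in> H1" and e: "0 < e"
  shows "\<exists>p. L2_inner (\<lambda>x. u x - expoly a p x) (\<lambda>x. u x - expoly a p x)
    + L2_inner (wderiv (\<lambda>x. u x - expoly a p x)) (wderiv (\<lambda>x. u x - expoly a p x))
    + (u 0 - expoly a p 0)\<^sup>2 < e"
proof -
  have h: "(\<lambda>x. wderiv u x - u x) \<in> L2" by (intro L2.diff_mem H1_wderiv H1_L2 u)
  then have "(\<lambda>x. wderiv u x - u x) \<in> L2_closure (range (expoly a))"
    using expoly_dense_L2[OF a] by simp
  then obtain q where q: "L2_inner (\<lambda>x. wderiv u x - u x - expoly a q x) (\<lambda>x. wderiv u x - u x - expoly a q x) < e"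
    using e unfolding L2_closure_def by blast
  obtain p where p: "pderiv p - smult (a + 1) p = q"
    using pderiv_minus_smult_surj[of "a + 1" q] a by auto
  define w where "w = (\<lambda>x. u x - expoly a p x)"
  let ?p' = "expoly a (pderiv p - smult a p)"
  have p': "?p' \<in> L2" "expoly a p \<in> H1" using a by (auto intro: expoly_L2 expoly_H1)
  have w: "w \<in> H1" unfolding w_def by (intro Dirichlet.diff_mem u p')
  have "is_weak_deriv w (\<lambda>x. wderiv u x + (-1) * ?p' x)"
    using is_weak_deriv_add[OF H1_L2[OF u] L2_scale[OF H1_L2[OF p'(2)], of "-1"] H1_wderiv(1)[OF u]
        L2_scale[OF p'(1), of "-1"] H1_wderiv(2)[OF u]
        is_weak_deriv_scale[OF H1_L2[OF p'(2)] p'(1) expoly_weak_deriv, of "-1"]]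
    unfolding w_def by simp
  then have w': "AE x in lebesgue_on Lam. wderiv w x = wderiv u x + (-1) * ?p' x"
    by (intro wderiv_AE_eq w L2_add L2_scale H1_wderiv u p')
  define r where "r = (\<lambda>x. wderiv w x - w x)"
  have r: "r \<in> L2" unfolding r_def by (intro L2.diff_mem H1_wderiv H1_L2 w)
  have "AE x in lebesgue_on Lam. r x = wderiv u x - u x - expoly a q x"
    using w'
  proof eventually_elim
    case (elim x)
    have "expoly a q x = ?p' x - expoly a p x"
      unfolding p[symmetric] by (simp add: expoly_def algebra_simps)
    then show ?case unfolding r_def elim by (simp add: w_def)
  qed
  then have "L2_inner r r = L2_inner (\<lambda>x. wderiv u x - u x - expoly a q x) (\<lambda>x. wderiv u x - u x - expoly a q x)"
    unfolding L2_inner_def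
    by (intro integral_cong_AE borel_measurable_times L2_measurable r L2.diff_mem[OF h] expoly_L2 a)
      (auto elim: eventually_mono)
  moreover have "L2_inner r r = L2_inner (wderiv w) (wderiv w) + L2_inner w w + (w 0)\<^sup>2"
    using L2.norm_diff[OF H1_wderiv(1)[OF w] H1_L2[OF w]] H1_integration_by_parts[OF w w]
      L2.commute[of w "wderiv w"] unfolding r_def by (simp add: power2_eq_square)
  ultimately show ?thesis
    using q unfolding w_def by (intro exI[of _ p]) linarith
qed

section \<open>Expansion in Sobolev orthogonal Laguerre functions\<close>

lemma poly_combination_of_degree_basis:
  fixes P :: "nat \<Rightarrow> real poly"
  assumes P: "\<And>k. coeff (P k) k \<noteq> 0" "\<And>k i. k < i \<Longrightarrow> coeff (P k) i = 0"
    and p: "\<And>i. n \<le> i \<Longrightarrow> coeff p i = 0"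
  shows "\<exists>d. p = (\<Sum>k<n. smult (d k) (P k))"
  using p
proof (induction n arbitrary: p)
  case 0
  then have "p = 0" by (intro poly_eqI) simp
  then show ?case by simp
next
  case (Suc n)
  define c where "c = coeff p n / coeff (P n) n"
  have "coeff (p - smult c (P n)) i = 0" if "n \<le> i" for i
    using that Suc.prems[of i] P(1)[of n] P(2)[of n i] by (cases "i = n") (auto simp: c_def)
  then obtain d where d: "p - smult c (P n) = (\<Sum>k<n. smult (d k) (P k))"
    using Suc.IH by blast
  have "p = (\<Sum>k<Suc n. smult ((d(n := c)) k) (P k))"
    using d by (simp add: algebra_simps)
  then show ?case by blast
qed

lemma expoly_sum: "expoly a (\<Sum>k\<in>I. smult (d k) (P k)) = (\<lambda>x. \<Sum>k\<in>I. d k * expoly a (P k) x)"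
  by (simp add: expoly_def poly_sum fun_eq_iff sum_distrib_left mult.left_commute)

lemma expoly_eq_iff: "expoly a p = expoly a q \<longleftrightarrow> p = q"
  by (auto simp: expoly_def fun_eq_iff poly_eq_poly_eq_iff[symmetric])

lemma expoly_zero_on_half_line:
  assumes "\<And>x. 0 \<le> x \<Longrightarrow> expoly a p x = 0"
  shows "p = 0"
proof (rule ccontr)
  assume "p \<noteq> 0"
  then have "finite {x. poly p x = 0}" by (rule poly_roots_finite)
  moreover have "{0..} \<subseteq> {x. poly p x = 0}" using assms by (auto simp: expoly_def)
  ultimately have "finite {0::real..}" by (rule rev_finite_subset)
  then show False using infinite_Ici by blast
qed

lemma H1_trace_square:
  assumes "w \<in> H1"
  shows "(w 0)\<^sup>2 = - 2 * L2_inner (wderiv w) w"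
  using H1_integration_by_parts[OF assms assms] L2.commute[of w "wderiv w"]
  by (simp add: power2_eq_square)

lemma H1_trace_le:
  assumes "w \<in> H1"
  shows "((w 0)\<^sup>2)\<^sup>2 \<le> 4 * (L2_inner (wderiv w) (wderiv w) * L2_inner w w)"
  using L2.Cauchy_Schwarz[OF H1_wderiv(1)[OF assms] H1_L2[OF assms]] H1_trace_square[OF assms]
  by (simp add: power_mult_distrib)

lemma H1_increment_le:
  assumes "w \<in> H1" "0 \<le> x"
  shows "(w x - w 0)\<^sup>2 \<le> L2_inner (wderiv w) (wderiv w) * L2_inner (indicator {0<..x}) (indicator {0<..x})"
  using L2.Cauchy_Schwarz[OF H1_wderiv(1)[OF assms(1)] interval_indicator_L2[of 0 x]]
    H1_increment[OF assms(1) order_refl assms(2)] by simp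

lemma H1_wderiv_norm_0:
  assumes w: "w \<in> H1" and 0: "L2_inner (wderiv w) (wderiv w) = 0" and x: "0 \<le> x"
  shows "w x = 0"
  using H1_trace_le[OF w] H1_increment_le[OF w x] 0 by simp

text \<open>
  Pointwise convergence is reduced to the trace and the derivative because these remain
  accessible for \<open>\<gamma> = 0\<close>, when the Robin form does not control the \<open>L\<^sup>2\<close> norm.
\<close>

lemma H1_pointwise_tendsto_0:
  assumes w: "\<And>n. w n \<in> H1" and trace: "(\<lambda>n. (w n 0)\<^sup>2) \<longlonglongrightarrow> 0"
    and deriv: "(\<lambda>n. L2_inner (wderiv (w n)) (wderiv (w n))) \<longlonglongrightarrow> 0" and x: "0 \<le> x"
  shows "(\<lambda>n. w n x) \<longlonglongrightarrow> 0"
proof -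
  have "(\<lambda>n. L2_inner (wderiv (w n)) (wderiv (w n)) * L2_inner (indicator {0<..x}) (indicator {0<..x})) \<longlonglongrightarrow> 0"
    using tendsto_mult_right[OF deriv] by simp
  then have "(\<lambda>n. (w n x - w n 0)\<^sup>2) \<longlonglongrightarrow> 0"
    by (rule Lim_null_comparison[rotated]) (use H1_increment_le[OF w x] in simp)
  then have "(\<lambda>n. w n x - w n 0) \<longlonglongrightarrow> 0" by (simp add: power_tendsto_0_iff)
  moreover have "(\<lambda>n. w n 0) \<longlonglongrightarrow> 0" using trace by (simp add: power_tendsto_0_iff)
  ultimately show ?thesis using tendsto_add by fastforce
qed

definition laguerre_poly :: "real \<Rightarrow> real \<Rightarrow> nat \<Rightarrow> real poly" where
  "laguerre_poly \<alpha> \<beta> k = (\<Sum>\<nu>\<le>k. monom (pochhammer (\<alpha> + real \<nu> + 1) (k - \<nu>) / (fact (k - \<nu>) * fact \<nu>) * (- \<beta>) ^ \<nu>) \<nu>)"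

lemma laguerre_fun_eq_expoly: "laguerre_fun \<alpha> \<beta> k = expoly (\<beta> / 2) (laguerre_poly \<alpha> \<beta> k)"
proof
  fix x
  have "(- (\<beta> * x)) ^ \<nu> = (- \<beta>) ^ \<nu> * x ^ \<nu>" for \<nu>
    by (simp flip: power_mult_distrib)
  then show "laguerre_fun \<alpha> \<beta> k x = expoly (\<beta> / 2) (laguerre_poly \<alpha> \<beta> k) x"
    by (simp add: laguerre_fun_def gen_laguerre_def expoly_def laguerre_poly_def poly_sum poly_monom mult.assoc)
qed

lemma laguerre_poly_coeff:
  shows "coeff (laguerre_poly \<alpha> \<beta> k) k = (- \<beta>) ^ k / fact k"
    and "k < i \<Longrightarrow> coeff (laguerre_poly \<alpha> \<beta> k) i = 0"
  by (auto simp: laguerre_poly_def coeff_sum intro: sum.neutral)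

locale sobolev_laguerre_basis =
  fixes \<beta> \<gamma> \<mu> :: real and R :: "nat \<Rightarrow> real \<Rightarrow> real" and \<rho> :: "nat \<Rightarrow> real"
  assumes \<beta>: "0 < \<beta>" and \<gamma>: "0 \<le> \<gamma>" and \<mu>: "0 \<le> \<mu>" and basis: "sobolev_laguerre \<beta> \<gamma> \<mu> R \<rho>"
begin

lemma X_H1: "v \<in> X \<beta> n \<Longrightarrow> v \<in> H1"
  using \<beta> by (auto simp: X_eq_expoly intro: expoly_H1)

lemma R_H1: "R k \<in> H1"
  using basis X_H1 unfolding sobolev_laguerre_def by blast

lemma R_orth: "robin_form \<gamma> \<mu> (R k) (R m) = (if k = m then \<rho> k else 0)"
  using basis unfolding sobolev_laguerre_def by blast

text \<open>
  The generalized Laguerre polynomials have exact degree \<open>k\<close>, also for \<open>\<alpha> = - 1\<close>, and \<open>R k\<close> inherits this.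
  So the polynomial parts of the \<open>R k\<close> form a triangular basis.
\<close>

lemma R_poly_exists:
  "\<exists>p. R k = expoly (\<beta> / 2) p \<and> coeff p k \<noteq> 0 \<and> (\<forall>i>k. coeff p i = 0)"
proof -
  have "R k \<in> X \<beta> (int k)" "(\<lambda>x. R k x - laguerre_fun (- 1) \<beta> k x) \<in> X \<beta> (int k - 1)"
    using basis unfolding sobolev_laguerre_def by blast+
  then obtain p r where p: "R k = expoly (\<beta> / 2) p"
    and r: "(\<lambda>x. R k x - laguerre_fun (- 1) \<beta> k x) = expoly (\<beta> / 2) r" "r = 0 \<or> int (degree r) \<le> int k - 1"
    unfolding X_eq_expoly by blast
  have "expoly (\<beta> / 2) (p - laguerre_poly (- 1) \<beta> k) = expoly (\<beta> / 2) r"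
    unfolding expoly_diff using r(1) p laguerre_fun_eq_expoly by simp
  then have "p = r + laguerre_poly (- 1) \<beta> k" unfolding expoly_eq_iff by (simp add: algebra_simps)
  moreover have "coeff r i = 0" if "k \<le> i" for i
    using r(2) that by (auto intro: coeff_eq_0)
  ultimately show ?thesis
    using p \<beta> laguerre_poly_coeff[where \<alpha> = "-1" and \<beta> = \<beta> and k = k] by (intro exI[of _ p]) auto
qed

definition R_poly :: "nat \<Rightarrow> real poly" where
  "R_poly k = (SOME p. R k = expoly (\<beta> / 2) p \<and> coeff p k \<noteq> 0 \<and> (\<forall>i>k. coeff p i = 0))"

lemma R_eq: "R k = expoly (\<beta> / 2) (R_poly k)" and R_poly_coeff: "coeff (R_poly k) k \<noteq> 0" "k < i \<Longrightarrow> coeff (R_poly k) i = 0"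
  using someI_ex[OF R_poly_exists[of k]] unfolding R_poly_def[symmetric] by blast+

lemma expoly_combination:
  assumes "\<And>i. n \<le> i \<Longrightarrow> coeff p i = 0"
  shows "\<exists>d. expoly (\<beta> / 2) p = (\<lambda>x. \<Sum>k<n. d k * R k x)"
proof -
  have "\<exists>d. p = (\<Sum>k<n. smult (d k) (R_poly k))"
    by (rule poly_combination_of_degree_basis[OF R_poly_coeff assms])
  then obtain d where "p = (\<Sum>k<n. smult (d k) (R_poly k))" ..
  then have "expoly (\<beta> / 2) p = (\<lambda>x. \<Sum>k<n. d k * R k x)"
    by (simp only: expoly_sum R_eq[symmetric])
  then show ?thesis by (intro exI)
qed

lemma robin_self: "robin_form \<gamma> \<mu> w w = \<mu> * (w 0)\<^sup>2 + L2_inner (wderiv w) (wderiv w) + \<gamma> * L2_inner w w"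
  by (simp add: robin_form_def power2_eq_square)

lemma robin_self_ge:
  assumes "w \<in> H1"
  shows "L2_inner (wderiv w) (wderiv w) \<le> robin_form \<gamma> \<mu> w w" "\<mu> * (w 0)\<^sup>2 \<le> robin_form \<gamma> \<mu> w w"
    "\<gamma> * L2_inner w w \<le> robin_form \<gamma> \<mu> w w"
  using \<gamma> \<mu> L2.nonneg[OF H1_L2[OF assms]] Dirichlet.nonneg[OF assms]
    mult_nonneg_nonneg[OF \<mu> zero_le_power2[of "w 0"]] mult_nonneg_nonneg[OF \<gamma> L2.nonneg[OF H1_L2[OF assms]]]
  unfolding robin_self by linarith+

text \<open>
  A function whose weak derivative has norm zero is constant, and the constant is \<open>0\<close> because the
  trace is bounded by the product of the norms of the function and its derivative. This covers \<open>\<gamma> = \<mu> = 0\<close>.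
\<close>

lemma \<rho>_pos: "0 < \<rho> k"
proof -
  have "R_poly k \<noteq> 0" using R_poly_coeff(1)[of k] by auto
  then obtain x where x: "0 \<le> x" "R k x \<noteq> 0"
    using expoly_zero_on_half_line[of "\<beta> / 2" "R_poly k"] unfolding R_eq[symmetric] by blast
  then have "0 < L2_inner (wderiv (R k)) (wderiv (R k))"
    using H1_wderiv_norm_0[OF R_H1 _ x(1)] Dirichlet.nonneg[OF R_H1] by (metis less_eq_real_def)
  then show ?thesis using robin_self_ge(1)[OF R_H1, of k] R_orth[of k k] by simp
qed

sublocale robin: orthogonal_family H1 "robin_form \<gamma> \<mu>" R \<rho>
  by (intro orthogonal_family.intro robin_semi_inner \<gamma> \<mu> orthogonal_family_axioms.intro R_H1 R_orth \<rho>_pos)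

lemma partial_energy_tendsto_0:
  assumes u: "u \<in> H1"
  shows "(\<lambda>n. robin_form \<gamma> \<mu> (\<lambda>x. u x - robin.partial u n x) (\<lambda>x. u x - robin.partial u n x)) \<longlonglongrightarrow> 0"
proof (rule LIMSEQ_I)
  fix e :: real assume "0 < e"
  define K where "K = 1 + \<gamma> + \<mu>"
  have K: "0 < K" using \<gamma> \<mu> by (simp add: K_def)
  then have "0 < e / K" using \<open>0 < e\<close> by simp
  then obtain p where p: "L2_inner (\<lambda>x. u x - expoly (\<beta> / 2) p x) (\<lambda>x. u x - expoly (\<beta> / 2) p x)
      + L2_inner (wderiv (\<lambda>x. u x - expoly (\<beta> / 2) p x)) (wderiv (\<lambda>x. u x - expoly (\<beta> / 2) p x))
      + (u 0 - expoly (\<beta> / 2) p 0)\<^sup>2 < e / K"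
    using expoly_dense_H1[OF _ u, of "\<beta> / 2" "e / K"] \<beta> by auto
  define w where "w = (\<lambda>x. u x - expoly (\<beta> / 2) p x)"
  have w: "w \<in> H1"
    unfolding w_def using \<beta> by (intro Dirichlet.diff_mem u expoly_H1) simp
  have "robin_form \<gamma> \<mu> w w \<le> K * (L2_inner w w + L2_inner (wderiv w) (wderiv w) + (w 0)\<^sup>2)"
  proof -
    have nonneg: "0 \<le> L2_inner w w" "0 \<le> L2_inner (wderiv w) (wderiv w)" "0 \<le> (w 0)\<^sup>2"
      using L2.nonneg[OF H1_L2[OF w]] Dirichlet.nonneg[OF w] by auto
    then have "0 \<le> \<gamma> * L2_inner (wderiv w) (wderiv w)" "0 \<le> \<gamma> * (w 0)\<^sup>2"
      "0 \<le> \<mu> * L2_inner w w" "0 \<le> \<mu> * L2_inner (wderiv w) (wderiv w)"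
      using \<gamma> \<mu> by auto
    then show ?thesis
      using nonneg unfolding robin_self K_def by (simp add: distrib_left distrib_right)
  qed
  also have "\<dots> < K * (e / K)"
    using p K unfolding w_def by (intro mult_strict_left_mono)
  finally have small: "robin_form \<gamma> \<mu> w w < e" using K by simp
  show "\<exists>n0. \<forall>n\<ge>n0. norm (robin_form \<gamma> \<mu> (\<lambda>x. u x - robin.partial u n x) (\<lambda>x. u x - robin.partial u n x) - 0) < e"
  proof (intro exI allI impI)
    fix n assume n: "Suc (degree p) \<le> n"
    have "coeff p i = 0" if "n \<le> i" for i using n that by (intro coeff_eq_0) simp
    from expoly_combination[OF this] obtain d where "expoly (\<beta> / 2) p = (\<lambda>x. \<Sum>k<n. d k * R k x)" ..
    then have "robin_form \<gamma> \<mu> (\<lambda>x. u x - robin.partial u n x) (\<lambda>x. u x - robin.partial u n x) \<le> robin_form \<gamma> \<mu> w w"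
      using robin.best_approximation[OF u, of n d] unfolding w_def by simp
    then show "norm (robin_form \<gamma> \<mu> (\<lambda>x. u x - robin.partial u n x) (\<lambda>x. u x - robin.partial u n x) - 0) < e"
      using small robin.nonneg[OF robin.diff_mem[OF u robin.partial_mem[of u n]]] by simp
  qed
qed

text \<open>
  For \<open>\<gamma> = \<mu> = 0\<close> the energy is only \<open>\<parallel>w'\<parallel>\<^sup>2\<close>, which does not control \<open>w 0\<close> on an unbounded
  interval, so the trace of the residual \<open>w = u - partial u (n + 1)\<close> needs an identity of its own.
  Write \<open>\<psi> n\<close> for the derivative of \<open>R n\<close> and \<open>a = \<beta> / 2\<close>. Derivatives of
  span \<open>{R 0, \<dots>, R n}\<close> fill the whole span. So \<open>w'\<close> is orthogonal to \<open>R n\<close>, and integration by parts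
  gives \<open>w 0 * R n 0 = - (w, \<psi> n)\<close>. For the same reason \<open>\<psi> n\<close> is orthogonal to the earlier
  \<open>R k\<close>, so that \<open>(w, \<psi> n) = (u, \<psi> n) - c * (R n, \<psi> n)\<close> with the coefficient \<open>c = (u', \<psi> n) / \<rho> n\<close>, and
  \<open>2 * (R n, \<psi> n) = - (R n 0)\<^sup>2\<close>. Finally \<open>\<rho> n = a / 2 * (R n 0)\<^sup>2\<close>. Dividing by \<open>R n 0\<close> expresses \<open>w 0\<close>
  through normalized Fourier coefficients of \<open>u\<close> and \<open>u'\<close>, and these tend to \<open>0\<close> by Bessel.
\<close>

lemma trace_tendsto_0_Neumann:
  assumes u: "u \<in> H1" and "\<gamma> = 0" "\<mu> = 0"
  shows "(\<lambda>n. (u 0 - robin.partial u n 0)\<^sup>2) \<longlonglongrightarrow> 0"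
proof -
  define a where "a = \<beta> / 2"
  have a: "0 < a" using \<beta> by (simp add: a_def)
  have robin: "robin_form \<gamma> \<mu> = (\<lambda>v w. L2_inner (wderiv v) (wderiv w))"
    using assms(2,3) by (simp add: robin_form_def fun_eq_iff)
  define \<psi> where "\<psi> k = wderiv (R k)" for k
  have \<psi>: "\<psi> k \<in> L2" for k unfolding \<psi>_def by (intro H1_wderiv R_H1)
  interpret \<psi>: orthogonal_family L2 L2_inner \<psi> \<rho>
    using \<psi> R_orth \<rho>_pos unfolding robin \<psi>_def by unfold_locales auto
  \<comment> \<open>every \<open>expoly a r\<close> of degree below \<open>n\<close> is the derivative of a combination of \<open>R 0, \<dots>, R (n - 1)\<close>\<close>
  have deriv_orth: "L2_inner (wderiv w) (expoly a r) = 0"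
    if w: "w \<in> H1" and orth: "\<And>d. L2_inner (wderiv w) (wderiv (\<lambda>x. \<Sum>k<n. d k * R k x)) = 0"
      and r: "\<And>i. n \<le> i \<Longrightarrow> coeff r i = 0" for w r n
  proof -
    obtain p where p: "degree p \<le> degree r" "pderiv p - smult a p = r"
      using pderiv_minus_smult_surj[of a r] a by auto
    have "coeff p i = 0" if "n \<le> i" for i
    proof (cases "r = 0")
      case True
      then have "degree p = 0" "pderiv p = smult a p" using p by auto
      then have "p = 0" using a by (simp add: pderiv_eq_0_iff[THEN iffD2])
      then show ?thesis by simp
    next
      case False
      then have "degree r < n" using r[of "degree r"] by (metis leading_coeff_0_iff not_le)
      then show ?thesis using p(1) that by (intro coeff_eq_0) simp
    qed
    from expoly_combination[OF this] obtain d where d: "expoly a p = (\<lambda>x. \<Sum>k<n. d k * R k x)"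
      unfolding a_def ..
    have "L2_inner (wderiv (expoly a p)) (wderiv w) = L2_inner (expoly a r) (wderiv w)"
      using expoly_weak_deriv[of a p] unfolding p(2)
      by (intro L2_inner_wderiv expoly_H1 expoly_L2 H1_wderiv w a)
    then show ?thesis using orth[of d] L2.commute unfolding d by metis
  qed
  have bound: "(u 0 - robin.partial u (Suc n) 0)\<^sup>2 \<le> a * ((L2_inner u (\<psi> n))\<^sup>2 / \<rho> n)
      + 1 / a * ((L2_inner (wderiv u) (\<psi> n))\<^sup>2 / \<rho> n)" for n
  proof -
    define w where "w = (\<lambda>x. u x - robin.partial u (Suc n) x)"
    have w: "w \<in> H1" unfolding w_def by (intro robin.diff_mem robin.partial_mem u)
    define c where "c = L2_inner (wderiv u) (\<psi> n) / \<rho> n"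
    have \<psi>_orth: "L2_inner (\<psi> n) (expoly a r) = 0" if "\<And>i. n \<le> i \<Longrightarrow> coeff r i = 0" for r
    proof (unfold \<psi>_def, rule deriv_orth[OF R_H1 _ that])
      fix d
      have "robin_form \<gamma> \<mu> (\<lambda>x. \<Sum>k<n. d k * R k x) (R n) = (\<Sum>k<n. d k * robin_form \<gamma> \<mu> (R k) (R n))"
        by (rule robin.sum_left) (auto intro: R_H1)
      then show "L2_inner (wderiv (R n)) (wderiv (\<lambda>x. \<Sum>k<n. d k * R k x)) = 0"
        using R_orth[of _ n] robin.commute[of "R n"] unfolding robin by simp
    qed
    have R_expoly: "R n = expoly a (R_poly n)" unfolding a_def by (rule R_eq)
    have RL2: "R k \<in> L2" for k by (intro H1_L2 R_H1)
    have R\<psi>: "L2_inner (\<psi> n) (R n) = - (R n 0)\<^sup>2 / 2"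
      using H1_trace_square[OF R_H1, of n] unfolding \<psi>_def by simp
    have \<rho>: "\<rho> n = a / 2 * (R n 0)\<^sup>2"
    proof -
      have "\<rho> n = L2_inner (\<psi> n) (\<psi> n)" using \<psi>.orth[of n n] by simp
      also have "\<dots> = L2_inner (expoly a (pderiv (R_poly n) - smult a (R_poly n))) (\<psi> n)"
        using L2_inner_wderiv[OF R_H1 expoly_L2[OF a] _ \<psi>, of n _ n] expoly_weak_deriv[of a "R_poly n"]
        unfolding \<psi>_def R_expoly by metis
      also have "\<dots> = L2_inner (expoly a (pderiv (R_poly n))) (\<psi> n) - a * L2_inner (R n) (\<psi> n)"
        unfolding expoly_diff expoly_smult R_expoly[symmetric]
        using L2.diff_left[OF expoly_L2[OF a] L2_scale[OF RL2] \<psi>] L2.scale_left[OF RL2 \<psi>] by simp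
      \<comment> \<open>differentiation lowers the degree, so this term is orthogonal to \<open>\<psi> n\<close>\<close>
      also have "L2_inner (expoly a (pderiv (R_poly n))) (\<psi> n) = 0"
        using \<psi>_orth[of "pderiv (R_poly n)"] R_poly_coeff(2)[of n] L2.commute by (simp add: coeff_pderiv)
      finally show ?thesis using R\<psi> L2.commute[of "R n" "\<psi> n"] by simp
    qed
    have R0: "R n 0 \<noteq> 0" using \<rho> \<rho>_pos[of n] by auto
    have "L2_inner (wderiv w) (R n) = 0"
      unfolding R_expoly
    proof (rule deriv_orth[OF w])
      show "L2_inner (wderiv w) (wderiv (\<lambda>x. \<Sum>k<Suc n. d k * R k x)) = 0" for d
        using robin.residual_orth_combination[OF u, of "Suc n" d] unfolding w_def robin .
      show "coeff (R_poly n) i = 0" if "Suc n \<le> i" for i using R_poly_coeff(2) that by simp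
    qed
    then have "L2_inner w (\<psi> n) = - (w 0 * R n 0)"
      using H1_integration_by_parts[OF w R_H1, of n] unfolding \<psi>_def by simp
    moreover have "L2_inner w (\<psi> n) = L2_inner u (\<psi> n) + c * (R n 0)\<^sup>2 / 2"
    proof -
      have split: "robin.partial u (Suc n) = (\<lambda>x. robin.partial u n x + c * R n x)"
      proof -
        have "c = robin_form \<gamma> \<mu> u (R n) / \<rho> n" by (simp add: c_def \<psi>_def robin)
        then show ?thesis by (simp add: robin.partial_def)
      qed
      obtain r where r: "robin.partial u n = expoly a r" "\<And>i. n \<le> i \<Longrightarrow> coeff r i = 0"
      proof
        let ?r = "\<Sum>k<n. smult (robin_form \<gamma> \<mu> u (R k) / \<rho> k) (R_poly k)"
        show "robin.partial u n = expoly a ?r"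
          unfolding robin.partial_def expoly_sum a_def R_eq[symmetric] ..
        show "coeff ?r i = 0" if "n \<le> i" for i
          using that R_poly_coeff(2) by (simp add: coeff_sum)
      qed
      have pL2: "robin.partial u n \<in> L2" by (intro H1_L2 robin.partial_mem)
      have "L2_inner (robin.partial u n) (\<psi> n) = 0"
        unfolding r(1) using \<psi>_orth[OF r(2)] L2.commute by metis
      then have "L2_inner (robin.partial u (Suc n)) (\<psi> n) = c * L2_inner (R n) (\<psi> n)"
        unfolding split using L2.add_left[OF pL2 L2_scale[OF RL2] \<psi>] L2.scale_left[OF RL2 \<psi>] by simp
      then show ?thesis
        unfolding w_def using L2.diff_left[OF H1_L2[OF u] H1_L2[OF robin.partial_mem] \<psi>] R\<psi> L2.commute[of "R n" "\<psi> n"]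
        by simp
    qed
    ultimately have "w 0 * R n 0 = - (L2_inner u (\<psi> n) + c * (R n 0)\<^sup>2 / 2)" by simp
    then have "(w 0 * R n 0)\<^sup>2 = (L2_inner u (\<psi> n) + c * (R n 0)\<^sup>2 / 2)\<^sup>2" by (simp only: power2_minus)
    also have "\<dots> \<le> 2 * (L2_inner u (\<psi> n))\<^sup>2 + 2 * (c * (R n 0)\<^sup>2 / 2)\<^sup>2"
      using sum_squares_ge_zero zero_le_power2[of "L2_inner u (\<psi> n) - c * (R n 0)\<^sup>2 / 2"]
      unfolding power2_sum power2_diff by linarith
    finally have "(w 0)\<^sup>2 * (R n 0)\<^sup>2 \<le> 2 * (L2_inner u (\<psi> n))\<^sup>2 + 2 * (c * (R n 0)\<^sup>2 / 2)\<^sup>2"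
      by (simp add: power_mult_distrib)
    then have "(w 0)\<^sup>2 \<le> (2 * (L2_inner u (\<psi> n))\<^sup>2 + 2 * (c * (R n 0)\<^sup>2 / 2)\<^sup>2) / (R n 0)\<^sup>2"
      using R0 by (simp add: pos_le_divide_eq)
    also have "\<dots> = a * ((L2_inner u (\<psi> n))\<^sup>2 / \<rho> n) + 1 / a * ((L2_inner (wderiv u) (\<psi> n))\<^sup>2 / \<rho> n)"
      unfolding c_def \<rho> using R0 a by (simp add: field_simps power2_eq_square)
    finally show ?thesis unfolding w_def .
  qed
  have lim: "(\<lambda>n. a * ((L2_inner u (\<psi> n))\<^sup>2 / \<rho> n) + 1 / a * ((L2_inner (wderiv u) (\<psi> n))\<^sup>2 / \<rho> n)) \<longlonglongrightarrow> a * 0 + 1 / a * 0"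
    by (intro tendsto_add tendsto_mult tendsto_const \<psi>.normalized_coeff_tendsto_0 H1_L2 H1_wderiv u)
  have "(\<lambda>n. (u 0 - robin.partial u (Suc n) 0)\<^sup>2) \<longlonglongrightarrow> 0"
    by (rule Lim_null_comparison[OF _ lim[simplified]]) (use bound in simp)
  then show ?thesis by (rule filterlim_sequentially_Suc[THEN iffD1])
qed

text \<open>
  The energy dominates the norm of the derivative. The trace follows directly for \<open>\<mu> > 0\<close>, from
  \<open>(w 0)\<^sup>2 = - 2 * (w', w)\<close> for \<open>\<gamma> > 0\<close>, and from the preceding lemma otherwise.
\<close>

lemma partial_pointwise:
  assumes u: "u \<in> H1" and x: "0 \<le> x"
  shows "(\<lambda>n. u x - robin.partial u n x) \<longlonglongrightarrow> 0"
proof -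
  define w where "w n = (\<lambda>x. u x - robin.partial u n x)" for n
  have w: "w n \<in> H1" for n unfolding w_def by (intro robin.diff_mem robin.partial_mem u)
  have E: "(\<lambda>n. robin_form \<gamma> \<mu> (w n) (w n)) \<longlonglongrightarrow> 0"
    unfolding w_def by (rule partial_energy_tendsto_0[OF u])
  have D: "(\<lambda>n. L2_inner (wderiv (w n)) (wderiv (w n))) \<longlonglongrightarrow> 0"
    by (rule Lim_null_comparison[OF _ E]) (use robin_self_ge(1)[OF w] Dirichlet.nonneg[OF w] in simp)
  have "(\<lambda>n. (w n 0)\<^sup>2) \<longlonglongrightarrow> 0"
  proof -
    consider "0 < \<mu>" | "0 < \<gamma>" | "\<gamma> = 0" "\<mu> = 0" using \<gamma> \<mu> by linarith
    then show ?thesis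
    proof cases
      case 1
      have "(\<lambda>n. robin_form \<gamma> \<mu> (w n) (w n) / \<mu>) \<longlonglongrightarrow> 0 / \<mu>"
        by (intro tendsto_divide E tendsto_const) (use 1 in simp)
      then have lim: "(\<lambda>n. robin_form \<gamma> \<mu> (w n) (w n) / \<mu>) \<longlonglongrightarrow> 0" by simp
      show ?thesis
        by (rule Lim_null_comparison[OF _ lim])
          (use robin_self_ge(2)[OF w] 1 in \<open>simp add: pos_le_divide_eq mult.commute\<close>)
    next
      case 2
      have "(\<lambda>n. 4 * (L2_inner (wderiv (w n)) (wderiv (w n)) * (robin_form \<gamma> \<mu> (w n) (w n) / \<gamma>))) \<longlonglongrightarrow> 4 * (0 * (0 / \<gamma>))"
        by (intro tendsto_mult tendsto_divide D E tendsto_const) (use 2 in simp)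
      then have lim: "(\<lambda>n. 4 * (L2_inner (wderiv (w n)) (wderiv (w n)) * (robin_form \<gamma> \<mu> (w n) (w n) / \<gamma>))) \<longlonglongrightarrow> 0"
        by simp
      have "((w n 0)\<^sup>2)\<^sup>2 \<le> 4 * (L2_inner (wderiv (w n)) (wderiv (w n)) * (robin_form \<gamma> \<mu> (w n) (w n) / \<gamma>))" for n
      proof -
        have "L2_inner (w n) (w n) \<le> robin_form \<gamma> \<mu> (w n) (w n) / \<gamma>"
          using robin_self_ge(3)[OF w, of n] 2 by (simp add: pos_le_divide_eq mult.commute)
        from mult_left_mono[OF this Dirichlet.nonneg[OF w[of n]]]
        show ?thesis using H1_trace_le[OF w, of n] by linarith
      qed
      then have "(\<lambda>n. ((w n 0)\<^sup>2)\<^sup>2) \<longlonglongrightarrow> 0"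
        by (intro Lim_null_comparison[OF _ lim]) simp
      then show ?thesis by (simp only: power_tendsto_0_iff zero_less_numeral)
    next
      case 3
      then show ?thesis unfolding w_def by (rule trace_tendsto_0_Neumann[OF u])
    qed
  qed
  from H1_pointwise_tendsto_0[OF w this D x] show ?thesis unfolding w_def .
qed

end

theorem theorem1:
  fixes \<beta> \<gamma> \<mu> \<eta> :: real and N :: nat
    and f :: "(real \<Rightarrow> real) \<Rightarrow> real"
    and u uN :: "real \<Rightarrow> real"
    and R :: "nat \<Rightarrow> real \<Rightarrow> real" and \<rho> :: "nat \<Rightarrow> real"
  assumes "\<beta> > 0" and "\<gamma> \<ge> 0" and "\<mu> \<ge> 0"
    and "f \<in> H1_dual"
    and "sobolev_laguerre \<beta> \<gamma> \<mu> R \<rho>"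
    and "weak_solution \<gamma> \<mu> \<eta> f u"
    and "scheme_solution \<beta> \<gamma> \<mu> \<eta> N f uN"
  shows "\<exists>c :: nat \<Rightarrow> real.
    (\<forall>k. \<rho> k \<noteq> 0 \<and>
         c k = 1 / \<rho> k * robin_form \<gamma> \<mu> u (R k) \<and>
         c k = 1 / \<rho> k * (f (R k) + \<eta> * R k 0)) \<and>
    (\<forall>x\<ge>0. (\<lambda>k. c k * R k x) sums u x) \<and>
    (\<lambda>n. energy_norm \<gamma> \<mu> (\<lambda>x. u x - (\<Sum>k<n. c k * R k x))) \<longlonglongrightarrow> 0 \<and>
    (\<forall>x\<ge>0. uN x = (\<Sum>k\<le>N. c k * R k x))"
proof -
  interpret sobolev_laguerre_basis \<beta> \<gamma> \<mu> R \<rho>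
    using assms(1,2,3,5) by unfold_locales
  have u: "u \<in> H1" and weak: "\<And>v. v \<in> H1 \<Longrightarrow> robin_form \<gamma> \<mu> u v = f v + \<eta> * v 0"
    using assms(6) by (auto simp: weak_solution_def)
  define c where "c k = robin_form \<gamma> \<mu> u (R k) / \<rho> k" for k
  have partial: "robin.partial u n x = (\<Sum>k<n. c k * R k x)" for n x
    by (simp add: robin.partial_def c_def)
  have coeff: "\<rho> k \<noteq> 0 \<and> c k = 1 / \<rho> k * robin_form \<gamma> \<mu> u (R k) \<and>
      c k = 1 / \<rho> k * (f (R k) + \<eta> * R k 0)" for k
    using \<rho>_pos[of k] weak[OF R_H1, of k] by (simp add: c_def)
  have series: "(\<lambda>k. c k * R k x) sums u x" if "0 \<le> x" for x
    using tendsto_diff[OF tendsto_const[of "u x"] partial_pointwise[OF u that]]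
    by (simp add: sums_def partial)
  have energy: "(\<lambda>n. energy_norm \<gamma> \<mu> (\<lambda>x. u x - (\<Sum>k<n. c k * R k x))) \<longlonglongrightarrow> 0"
    using tendsto_real_sqrt[OF partial_energy_tendsto_0[OF u]]
    by (simp add: energy_norm_def partial)
  have uN: "uN \<in> X \<beta> (int N)" "\<And>v. v \<in> X \<beta> (int N) \<Longrightarrow> robin_form \<gamma> \<mu> uN v = f v + \<eta> * v 0"
    using assms(7) by (auto simp: scheme_solution_def)
  obtain p where p: "uN = expoly (\<beta> / 2) p" "p = 0 \<or> int (degree p) \<le> int N"
    using uN(1) unfolding X_eq_expoly by blast
  then have "coeff p i = 0" if "Suc N \<le> i" for i
    using that by (auto intro: coeff_eq_0)
  from expoly_combination[OF this] obtain d where d: "uN = (\<lambda>x. \<Sum>k<Suc N. d k * R k x)"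
    unfolding p(1) ..
  have "d k = c k" if "k < Suc N" for k
  proof -
    have "R k \<in> X \<beta> (int k)"
      using assms(5) unfolding sobolev_laguerre_def by blast
    then have "R k \<in> X \<beta> (int N)" using that by (auto simp: X_def)
    then have "robin_form \<gamma> \<mu> uN (R k) = robin_form \<gamma> \<mu> u (R k)"
      using uN(2) weak[OF R_H1] by simp
    moreover have "robin_form \<gamma> \<mu> uN (R k) = d k * \<rho> k"
      unfolding d using that by (intro robin.combination_coeff) auto
    ultimately show ?thesis using \<rho>_pos[of k] by (simp add: c_def nonzero_eq_divide_eq)
  qed
  then have "uN x = (\<Sum>k\<le>N. c k * R k x)" for x
    unfolding d lessThan_Suc_atMost[symmetric] by (intro sum.cong) auto
  then show ?thesis using coeff series energy by blast
qed

end
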